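(* Let $f$ be a function analytic in the open unit disc $D$ such that $f'\in H^1$. Then the Toeplitz operator $T_f$ on $H^\infty$ satisfies $$\|T_f\|_{H^\infty}\;\le\;\|f\|_{H^\infty}+\pi\,\|f'\|_{H^1}.$$
   Context: $D=\{\zeta\in\mathbb{C}:|\zeta|<1\}$ is the open unit disc, $T=\{\zeta\in\mathbb{C}:|\zeta|=1\}$ is the unit circle, and $m$ is normalized Lebesgue measure on $T$ (so $m(T)=1$). For $1\le p<\infty$, $H^p$ is the space of all functions $f$ analytic in $D$ with $$\|f\|_{H^p}=\sup_{0\le r<1}\left(\int_T|f(r\zeta)|^p\,dm(\zeta)\right)^{1/p}<\infty ,$$ and $H^\infty$ is the space of all functions $f$ analytic in $D$ with $\|f\|_{H^\infty}=\sup_{z\in D}|f(z)|<\infty$. Values on $T$ of functions in these spaces are their boundary values (radial limits, existing $m$-almost everywhere); when $f'\in H^1$, $f$ extends continuously to the closed disc $D\cup T$. For $f\in H^1$, the Toeplitz operator $T_f$ on $H^\infty$ is defined by $$(T_f h)(z)=\int_T\frac{\overline{f(\zeta)}\,h(\zeta)}{1-\overline{\zeta}z}\,dm(\zeta),\qquad h\in H^\infty,\ z\in D,$$ and $\|T_f\|_{H^\infty}=\sup\{\|T_f h\|_{H^\infty}: h\in H^\infty,\ \|h\|_{H^\infty}\le 1\}$ denotes its operator norm on $H^\infty$. *)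

theory Defs
  imports "HOL-Complex_Analysis.Complex_Analysis"
begin

definition circle_measure :: "complex measure" where
  "circle_measure =
     distr (uniform_measure lborel {0..2 * pi}) (restrict_space borel (sphere 0 1)) cis"

lemma space_circle_measure: "space circle_measure = sphere 0 1"
  by (simp add: circle_measure_def space_restrict_space)

lemma emeasure_circle_measure: "emeasure circle_measure (sphere 0 1) = 1"
proof -
  have "cis \<in> uniform_measure lborel {0..2 * pi} \<rightarrow>\<^sub>M restrict_space borel (sphere 0 1)"
    by (intro measurable_restrict_space2)
       (auto simp: measurable_cong_sets[OF sets_uniform_measure refl]
             intro!: borel_measurable_continuous_onI continuous_intros)
  then have "emeasure circle_measure (sphere 0 1) =
      emeasure (uniform_measure lborel {0..2 * pi}) (cis -` sphere 0 1)"
    by (simp add: circle_measure_def emeasure_distr sets_restrict_space_iff)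
  also have "cis -` sphere 0 1 = UNIV"
    by auto
  also have "emeasure (uniform_measure lborel {0..2 * pi}) UNIV = 1"
    by (simp add: divide_ennreal)
  finally show ?thesis .
qed

text \<open>
  All norms are suprema in \<^typ>\<open>ereal\<close>, so that membership in a space is finiteness of the norm
  and no bounds have to be presupposed. For \<open>f\<close> holomorphic on the disc and \<open>0 \<le> r < 1\<close> the
  inner integrand is continuous on the circle, so the Bochner integral is the genuine one.
\<close>

definition hardy_norm :: "real \<Rightarrow> (complex \<Rightarrow> complex) \<Rightarrow> ereal" where
  "hardy_norm p f =
     (SUP r\<in>{0..<1}. ereal ((LINT \<zeta>|circle_measure. norm (f (of_real r * \<zeta>)) powr p) powr (1 / p)))"

definition hardy :: "real \<Rightarrow> (complex \<Rightarrow> complex) set" where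
  "hardy p = {f. f holomorphic_on ball 0 1 \<and> hardy_norm p f < \<infinity>}"

definition hardy_inf_norm :: "(complex \<Rightarrow> complex) \<Rightarrow> ereal" where
  "hardy_inf_norm f = (SUP z\<in>ball 0 1. ereal (norm (f z)))"

definition hardy_inf :: "(complex \<Rightarrow> complex) set" where
  "hardy_inf = {f. f holomorphic_on ball 0 1 \<and> hardy_inf_norm f < \<infinity>}"

text \<open>
  Radial limit; where it does not exist (a null set for functions in Hardy spaces) the value is
  the unspecified constant supplied by \<^const>\<open>Lim\<close>.
\<close>

definition boundary_value :: "(complex \<Rightarrow> complex) \<Rightarrow> complex \<Rightarrow> complex" where
  "boundary_value f \<zeta> = Lim (at_left 1) (\<lambda>r::real. f (of_real r * \<zeta>))"

definition toeplitz :: "(complex \<Rightarrow> complex) \<Rightarrow> (complex \<Rightarrow> complex) \<Rightarrow> complex \<Rightarrow> complex" where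
  "toeplitz f h z =
     (LINT \<zeta>|circle_measure. cnj (boundary_value f \<zeta>) * boundary_value h \<zeta> / (1 - cnj \<zeta> * z))"

definition hardy_inf_opnorm ::
    "((complex \<Rightarrow> complex) \<Rightarrow> complex \<Rightarrow> complex) \<Rightarrow> ereal" where
  "hardy_inf_opnorm A = (SUP h\<in>{h \<in> hardy_inf. hardy_inf_norm h \<le> 1}. hardy_inf_norm (A h))"

end

theory Submission imports Defs begin

text \<open>
  The idea is to split the Cauchy kernel on the circle as
  \<open>1 / (1 - cnj \<zeta> * z) = P\<^sub>z(\<zeta>) - \<zeta> * cnj z / (1 - \<zeta> * cnj z)\<close> with the Poisson kernel \<open>P\<^sub>z\<close>, which is positive
  with integral one (\<open>poisson_kernel_split\<close>). The Poisson part of the Toeplitz integral is at most the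
  supremum of \<open>|f|\<close>. In the remaining part let \<open>U\<close> be a primitive of \<open>h w / (p - w)\<close>, where \<open>p = 1 / cnj z\<close> lies
  outside the disc. Integrating by parts on the circle gives the integral of \<open>cnj (\<zeta> * deriv f \<zeta>) * U \<zeta>\<close>.
  Now the mirror image of \<open>U\<close> in the line through \<open>0\<close> and \<open>p\<close> can be subtracted from \<open>U\<close> without changing the
  integral, as it is antiholomorphic; and the difference of \<open>U\<close> at two points symmetric to that line is at
  most \<open>\<pi>\<close>, since an arc centred at \<open>p\<close> joins them inside the disc under an angle below \<open>\<pi>\<close>
  (\<open>arc_reflection_bound\<close>). This proves the inequality for functions that are holomorphic beyond the
  closed disc (\<open>toeplitz_bound_smooth\<close>).

  The general case follows by applying this to dilations and letting the radius tend to one. Since the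
  right-hand side is infinite for unbounded \<open>f\<close>, both \<open>f\<close> and \<open>h\<close> may be assumed bounded, and dominated
  convergence applies once bounded holomorphic functions are known to have radial limits almost
  everywhere, which is Fatou's theorem (\<open>Fatou_radial_limits\<close>). It is proved here by a maximal
  inequality: the Poisson integral along a radius is controlled by averages over centred arcs
  (\<open>radial_bound_by_averages\<close>), whose supremum is controlled by Vitali's covering lemma
  (\<open>radial_maximal_inequality\<close>). Parseval's identity shows that a bounded function is close in mean to its
  dilations (\<open>dilation_mean_close\<close>), and the maximal inequality turns closeness in mean into closeness
  along almost every radius.
\<close>

section \<open>Integration over the circle and the Poisson kernel\<close>

lemma cis_measurable_circle:
  "cis \<in> uniform_measure lborel {0..2 * pi} \<rightarrow>\<^sub>M restrict_space borel (sphere 0 1)"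
  by (intro measurable_restrict_space2)
     (auto simp: measurable_cong_sets[OF sets_uniform_measure refl]
           intro!: borel_measurable_continuous_onI continuous_intros)

lemma sets_circle_measure: "sets circle_measure = sets (restrict_space borel (sphere 0 1))"
  by (simp add: circle_measure_def)

interpretation circle: finite_measure circle_measure
  by standard (simp add: space_circle_measure emeasure_circle_measure)

lemma borel_measurable_circle:
  fixes \<phi> :: "complex \<Rightarrow> 'a::euclidean_space"
  assumes "continuous_on (sphere 0 1) \<phi>"
  shows "\<phi> \<in> borel_measurable circle_measure"
  using borel_measurable_continuous_on_restrict[OF assms]
  by (simp add: measurable_cong_sets[OF sets_circle_measure refl])

lemma integrable_circle:
  fixes \<phi> :: "complex \<Rightarrow> 'a::euclidean_space"
  assumes "continuous_on (sphere 0 1) \<phi>"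
  shows "integrable circle_measure \<phi>"
proof -
  have "bounded (\<phi> ` sphere 0 1)"
    by (intro compact_imp_bounded compact_continuous_image assms) auto
  then obtain B where "\<And>\<zeta>. \<zeta> \<in> sphere 0 1 \<Longrightarrow> norm (\<phi> \<zeta>) \<le> B"
    unfolding bounded_iff by blast
  then show ?thesis
    by (intro circle.integrable_const_bound[where B = B] borel_measurable_circle assms AE_I2)
       (auto simp: space_circle_measure)
qed

lemma density_uniform_measure_circle:
  "uniform_measure lborel {0..2*pi} = density lborel (\<lambda>x. ennreal (indicator {0..2*pi} x / (2*pi)))"
  unfolding uniform_measure_def
  by (intro density_cong AE_I2)
     (auto simp: divide_ennreal[of 1 "2*pi", simplified] split: split_indicator)

lemma circle_integral_eq:
  fixes \<phi> :: "complex \<Rightarrow> 'a::euclidean_space"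
  assumes "continuous_on (sphere 0 1) \<phi>"
  shows "(LINT \<zeta>|circle_measure. \<phi> \<zeta>) = integral {0..2*pi} (\<lambda>t. \<phi> (cis t)) /\<^sub>R (2*pi)"
proof -
  have m: "\<phi> \<in> borel_measurable (restrict_space borel (sphere 0 1))"
    by (rule borel_measurable_continuous_on_restrict[OF assms])
  have c: "continuous_on UNIV (\<lambda>t. \<phi> (cis t))"
    by (rule continuous_on_compose2[OF assms]) (auto intro!: continuous_intros)
  have "(LINT \<zeta>|circle_measure. \<phi> \<zeta>) = (LINT t|uniform_measure lborel {0..2*pi}. \<phi> (cis t))"
    unfolding circle_measure_def by (rule integral_distr[OF cis_measurable_circle m])
  also have "\<dots> = (LINT t|lborel. (indicator {0..2*pi} t / (2*pi)) *\<^sub>R \<phi> (cis t))"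
    unfolding density_uniform_measure_circle
    by (rule integral_density)
       (auto intro!: borel_measurable_continuous_onI c simp del: borel_measurable_divide)
  also have "\<dots> = (LINT t|lborel. (1 / (2*pi)) *\<^sub>R (indicator {0..2*pi} t *\<^sub>R \<phi> (cis t)))"
    by (simp add: field_simps)
  also have "\<dots> = (1 / (2*pi)) *\<^sub>R (LINT t:{0..2*pi}|lborel. \<phi> (cis t))"
    unfolding set_lebesgue_integral_def by (rule integral_scaleR_right)
  also have "(LINT t:{0..2*pi}|lborel. \<phi> (cis t)) = integral {0..2*pi} (\<lambda>t. \<phi> (cis t))"
    by (intro set_borel_integral_eq_integral borel_integrable_atLeastAtMost' continuous_on_subset[OF c]) auto
  finally show ?thesis
    unfolding inverse_eq_divide .
qed

lemma one_minus_cnj_mult_neq_0: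
  assumes "norm z < 1" "norm \<zeta> = 1" shows "1 - cnj \<zeta> * z \<noteq> 0"
    using assms norm_mult[of "cnj \<zeta>" z] by (metis complex_mod_cnj eq_iff_diff_eq_0 mult_1 norm_one order_less_irrefl)

text \<open>
On the circle \<open>d\<zeta> / (2 \<pi> \<i> \<zeta>)\<close> is normalized arc length and \<open>1 / (1 - cnj \<zeta> * z) = \<zeta> / (\<zeta> - z)\<close>,
so this is Cauchy's integral formula.
\<close>

lemma circle_Cauchy_formula:
  assumes "continuous_on (cball 0 1) u" "u holomorphic_on ball 0 1" and z: "norm z < 1"
  shows "(LINT \<zeta>|circle_measure. u \<zeta> / (1 - cnj \<zeta> * z)) = u z"
proof -
  note nz = one_minus_cnj_mult_neq_0[OF z]
  have cont: "continuous_on (sphere 0 1) (\<lambda>\<zeta>. u \<zeta> / (1 - cnj \<zeta> * z))"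
    by (intro continuous_intros continuous_on_subset[OF assms(1)]) (use nz in auto)
  have "((\<lambda>\<zeta>. u \<zeta> / (\<zeta> - z)) has_contour_integral (2 * of_real pi * \<i> * u z)) (circlepath 0 1)"
    by (rule Cauchy_integral_circlepath) (use assms in auto)
  then have "((\<lambda>t. u (cis t) / (cis t - z) * (\<i> * cis t)) has_integral (2 * of_real pi * \<i> * u z)) {0..2*pi}"
    unfolding circlepath_def by (subst (asm) has_contour_integral_part_circlepath_iff) (auto simp: mult_ac)
  then have "((\<lambda>t. (1/(2*pi*\<i>)) * (u (cis t) / (cis t - z) * (\<i> * cis t))) has_integral ((1/(2*pi*\<i>)) * (2 * of_real pi * \<i> * u z))) {0..2*pi}"
    by (rule has_integral_mult_right)
  moreover have "(1/(2*pi*\<i>)) * (u (cis t) / (cis t - z) * (\<i> * cis t)) =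
       (u (cis t) / (1 - cnj (cis t) * z)) /\<^sub>R (2*pi)" for t
  proof -
    have "cis t * cnj (cis t) = 1"
      by (simp add: cis_mult cis_cnj)
    then have e: "cis t - z = cis t * (1 - cnj (cis t) * z)"
      by (metis mult.assoc mult_1 mult_1_right right_diff_distrib)
    show ?thesis unfolding e using nz[of "cis t"] by (simp add: divide_simps scaleR_conv_of_real)
  qed
  ultimately have "((\<lambda>t. (u (cis t) / (1 - cnj (cis t) * z)) /\<^sub>R (2*pi)) has_integral u z) {0..2*pi}"
    by simp
  then show ?thesis
    unfolding circle_integral_eq[OF cont] integral_cmul[symmetric] by (rule integral_unique)
qed

lemma circle_mean_value:
  assumes "continuous_on (cball 0 1) u" "u holomorphic_on ball 0 1"
  shows "(LINT \<zeta>|circle_measure. u \<zeta>) = u 0"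
  using circle_Cauchy_formula[OF assms, of 0] by simp

definition poisson_kernel :: "complex \<Rightarrow> complex \<Rightarrow> real" where
  "poisson_kernel z \<zeta> = (1 - (norm z)\<^sup>2) / (norm (1 - cnj \<zeta> * z))\<^sup>2"

text \<open>
The Poisson kernel is the real part of the Herglotz kernel. This splitting is what drives the
Toeplitz estimate: it trades the kernel \<open>1 / (1 - cnj \<zeta> * z)\<close>, whose pole \<open>z\<close> lies inside the disc, for a
positive kernel of mass one and a kernel with its pole \<open>1 / cnj z\<close> outside the disc.
\<close>

lemma poisson_kernel_split:
  assumes "norm z < 1" "norm \<zeta> = 1"
  shows "complex_of_real (poisson_kernel z \<zeta>) = 1 / (1 - cnj \<zeta> * z) + \<zeta> * cnj z / (1 - \<zeta> * cnj z)"
proof -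
  define w where "w = cnj \<zeta> * z"
  have n: "1 - w \<noteq> 0"
    using one_minus_cnj_mult_neq_0[OF assms] unfolding w_def .
  then have n': "1 - cnj w \<noteq> 0"
    by (metis complex_cnj_diff complex_cnj_one complex_cnj_zero_iff)
  have nw: "norm w = norm z" unfolding w_def using assms by (simp add: norm_mult)
  have "1 / (1 - w) + cnj w / (1 - cnj w) = (1 - w * cnj w) / ((1-w) * cnj (1 - w))"
    using n n' by (simp add: field_simps)
  also have "\<dots> = complex_of_real (poisson_kernel z \<zeta>)"
    unfolding poisson_kernel_def w_def[symmetric] nw[symmetric]
    by (simp only: of_real_divide of_real_diff of_real_1 complex_norm_square)
  finally show ?thesis unfolding w_def by simp
qed

lemma poisson_kernel_nonneg: "norm z < 1 \<Longrightarrow> 0 \<le> poisson_kernel z \<zeta>"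
  unfolding poisson_kernel_def by (auto simp: power_le_one)

lemma continuous_on_poisson_kernel:
  "norm z < 1 \<Longrightarrow> continuous_on (sphere 0 1) (poisson_kernel z)"
  unfolding poisson_kernel_def
  by (intro continuous_intros) (use one_minus_cnj_mult_neq_0 in auto)

text \<open>
The second summand of the splitting is holomorphic in \<open>\<zeta>\<close> and vanishes at the origin, hence
contributes nothing by the mean value property.
\<close>

lemma poisson_formula:
  assumes "continuous_on (cball 0 1) u" "u holomorphic_on ball 0 1" and z: "norm z < 1"
  shows "(LINT \<zeta>|circle_measure. u \<zeta> * poisson_kernel z \<zeta>) = u z"
proof -
  have nz: "1 - \<zeta> * cnj z \<noteq> 0" if "norm \<zeta> \<le> 1" for \<zeta>
  proof
    assume "1 - \<zeta> * cnj z = 0"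
    then have "norm (\<zeta> * cnj z) = 1" by (metis eq_iff_diff_eq_0 norm_one)
    moreover have "norm \<zeta> * norm z \<le> 1 * norm z" using that by (intro mult_right_mono) auto
    ultimately show False using z by (simp add: norm_mult)
  qed
  have cu: "continuous_on (sphere 0 1) u" by (rule continuous_on_subset[OF assms(1)]) auto
  have "(LINT \<zeta>|circle_measure. u \<zeta> * poisson_kernel z \<zeta>) =
        (LINT \<zeta>|circle_measure. u \<zeta> / (1 - cnj \<zeta> * z) + u \<zeta> * (\<zeta> * cnj z / (1 - \<zeta> * cnj z)))"
    by (intro Bochner_Integration.integral_cong refl)
       (use z in \<open>auto simp: space_circle_measure poisson_kernel_split distrib_left\<close>)
  also have "\<dots> = (LINT \<zeta>|circle_measure. u \<zeta> / (1 - cnj \<zeta> * z)) +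
        (LINT \<zeta>|circle_measure. u \<zeta> * (\<zeta> * cnj z / (1 - \<zeta> * cnj z)))"
    by (intro Bochner_Integration.integral_add integrable_circle continuous_intros cu)
       (use one_minus_cnj_mult_neq_0[OF z] nz in \<open>auto\<close>)
  also have "(LINT \<zeta>|circle_measure. u \<zeta> * (\<zeta> * cnj z / (1 - \<zeta> * cnj z))) = 0"
    by (subst circle_mean_value)
       (use nz in \<open>auto intro!: continuous_intros holomorphic_intros assms\<close>)
  finally show ?thesis
    using circle_Cauchy_formula[OF assms] by simp
qed

lemma integral_poisson_kernel:
  assumes "norm z < 1" shows "(LINT \<zeta>|circle_measure. poisson_kernel z \<zeta>) = 1"
proof -
  have "complex_of_real (LINT \<zeta>|circle_measure. poisson_kernel z \<zeta>) = 1"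
    using poisson_formula[of "\<lambda>_. 1" z] assms by (simp flip: integral_complex_of_real)
  then show ?thesis using of_real_eq_1_iff by blast
qed

section \<open>The inequality for functions smooth up to the boundary\<close>

lemma has_vector_derivative_cis: "(cis has_vector_derivative \<i> * cis t) (at t within X)"
  using has_derivative_cis[of "\<lambda>x. x" "\<lambda>x. x" t X] unfolding has_vector_derivative_def by simp

text \<open>
The source of the constant \<open>\<pi>\<close>. The point \<open>(sgn p)\<^sup>2 * cnj \<zeta>\<close> is the mirror image of \<open>\<zeta>\<close> in the
line through \<open>0\<close> and \<open>p\<close>. The two points have the same distance from \<open>p\<close>, so they are joined by an arc of
a circle centred at \<open>p\<close>; it stays inside the disc, and seen from \<open>p\<close> it subtends an angle less than \<open>\<pi>\<close>
because the disc lies in a half plane as seen from \<open>p\<close>. Along this arc \<open>dw / (p - w)\<close> has modulus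
\<open>d\<phi>\<close>, so the increment of \<open>U\<close> is bounded by the angle, however close \<open>p\<close> is to the disc.
\<close>

lemma arc_reflection_bound:
  assumes p: "1 < norm p" and \<zeta>: "norm \<zeta> = 1" and S: "cball 0 1 \<subseteq> S"
    and U: "\<And>w. w \<in> S \<Longrightarrow> (U has_field_derivative h w / (p - w)) (at w)"
    and h: "\<And>w. norm w \<le> 1 \<Longrightarrow> norm (h w) \<le> 1"
  shows "norm (U \<zeta> - U ((sgn p)\<^sup>2 * cnj \<zeta>)) \<le> pi"
proof -
  define x where "x = norm p"
  define \<eta> where "\<eta> = sgn p"
  have n\<eta>: "norm \<eta> = 1"
    using p by (auto simp: \<eta>_def norm_sgn)
  have p_eq: "p = \<eta> * of_real x"
    using p by (cases "p = 0") (simp_all add: \<eta>_def x_def sgn_eq)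
  have \<eta>\<eta>: "\<eta> * cnj \<eta> = 1"
    using n\<eta> by (metis complex_norm_square of_real_1 one_power2)
  have x: "1 < x" using p by (simp add: x_def)
  define q where "q = of_real x - cnj \<eta> * \<zeta>"
  define \<rho> where "\<rho> = norm q"
  define \<alpha> where "\<alpha> = Arg q"
  have nw: "norm (cnj \<eta> * \<zeta>) = 1" using n\<eta> \<zeta> by (simp add: norm_mult)
  have "Re (cnj \<eta> * \<zeta>) \<le> 1" using complex_Re_le_cmod[of "cnj \<eta> * \<zeta>"] nw by simp
  then have Req: "0 < Re q" using x by (simp add: q_def)
  then have \<rho>: "0 < \<rho>" by (auto simp: \<rho>_def)
  have q_eq: "q = of_real \<rho> * cis \<alpha>"
    unfolding \<rho>_def \<alpha>_def by (metis rcis_cmod_Arg rcis_def)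
  have \<alpha>: "\<bar>\<alpha>\<bar> < pi / 2"
    unfolding \<alpha>_def Arg_Re_pos using Req by blast
  \<comment> \<open>the arc, parametrized by the angle seen from the centre \<open>p\<close>\<close>
  define w where "w = (\<lambda>\<phi>. \<eta> * (of_real x - of_real \<rho> * cis \<phi>))"
  have w1: "w \<alpha> = \<zeta>"
    unfolding w_def q_eq[symmetric] q_def using \<eta>\<eta> by (simp flip: mult.assoc)
  have "of_real \<rho> * cis (-\<alpha>) = cnj q"
    by (simp add: q_eq cis_cnj)
  then have w2: "w (-\<alpha>) = \<eta>\<^sup>2 * cnj \<zeta>"
    unfolding w_def q_def by (simp add: power2_eq_square mult_ac)
  have norm_w: "(norm (w \<phi>))\<^sup>2 = x\<^sup>2 + \<rho>\<^sup>2 - 2 * x * \<rho> * cos \<phi>" for \<phi>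
  proof -
    have "(norm (w \<phi>))\<^sup>2 = (x - \<rho> * cos \<phi>)\<^sup>2 + (\<rho> * sin \<phi>)\<^sup>2"
      unfolding w_def by (simp add: norm_mult n\<eta> cmod_power2)
    also have "\<dots> = x\<^sup>2 + \<rho>\<^sup>2 * ((sin \<phi>)\<^sup>2 + (cos \<phi>)\<^sup>2) - 2 * x * \<rho> * cos \<phi>"
      by (simp add: power2_eq_square algebra_simps del: sin_cos_squared_add sin_cos_squared_add2 sin_cos_squared_add3)
    finally show ?thesis by simp
  qed
  have in_disc: "norm (w \<phi>) \<le> 1" if "\<bar>\<phi>\<bar> \<le> \<bar>\<alpha>\<bar>" for \<phi>
  proof -
    have "cos \<bar>\<alpha>\<bar> \<le> cos \<bar>\<phi>\<bar>"
      using that \<alpha> by (intro cos_monotone_0_pi_le) auto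
    then have "cos \<alpha> \<le> cos \<phi>" by simp
    then have "x * \<rho> * cos \<alpha> \<le> x * \<rho> * cos \<phi>"
      using x \<rho> by (intro mult_left_mono) auto
    then have "(norm (w \<phi>))\<^sup>2 \<le> (norm (w \<alpha>))\<^sup>2"
      unfolding norm_w by simp
    then show ?thesis
      using w1 \<zeta> abs_square_le_1[of "norm (w \<phi>)"] by simp
  qed
  define I where "I = {- \<bar>\<alpha>\<bar>..\<bar>\<alpha>\<bar>}"
  define D where "D = (\<lambda>\<phi>. (- (\<eta> * of_real \<rho> * (\<i> * cis \<phi>))) * (h (w \<phi>) / (p - w \<phi>)))"
  have deriv: "((U \<circ> w) has_vector_derivative D \<phi>) (at \<phi> within I)" if "\<phi> \<in> I" for \<phi>
  proof -
    have "(w has_vector_derivative (- (\<eta> * of_real \<rho> * (\<i> * cis \<phi>)))) (at \<phi> within I)"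
    proof -
      have "(w has_vector_derivative \<eta> * (0 - of_real \<rho> * (\<i> * cis \<phi>))) (at \<phi> within I)"
        unfolding w_def
        by (intro has_vector_derivative_mult_right has_vector_derivative_diff has_vector_derivative_const
            has_vector_derivative_cis)
      then show ?thesis by (simp add: mult.assoc)
    qed
    moreover have "(U has_field_derivative h (w \<phi>) / (p - w \<phi>)) (at (w \<phi>) within w ` I)"
    proof (rule has_field_derivative_at_within, rule U)
      have "norm (w \<phi>) \<le> 1"
        by (rule in_disc) (use that in \<open>auto simp: I_def\<close>)
      then show "w \<phi> \<in> S"
        using S by (meson mem_cball_0 subsetD)
    qed
    ultimately show ?thesis
      unfolding D_def by (rule field_vector_diff_chain_within)
  qed
  have bound: "norm (D \<phi>) \<le> 1" if "\<phi> \<in> I" for \<phi>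
  proof -
    have "p - w \<phi> = \<eta> * of_real \<rho> * cis \<phi>"
      unfolding w_def p_eq by (simp add: algebra_simps)
    then have "norm (D \<phi>) = norm (h (w \<phi>))"
      unfolding D_def using \<rho> n\<eta> by (auto simp: norm_mult norm_divide)
    then show ?thesis using h in_disc[of \<phi>] that by (auto simp: I_def)
  qed
  have "norm ((U \<circ> w) \<alpha> - (U \<circ> w) (-\<alpha>)) \<le> 1 * norm (\<alpha> - (-\<alpha>))"
  proof (rule differentiable_bound)
    show "convex I" by (simp add: I_def)
    show "((U \<circ> w) has_derivative (\<lambda>t. t *\<^sub>R D \<phi>)) (at \<phi> within I)" if "\<phi> \<in> I" for \<phi>
      using deriv[OF that] by (simp add: has_vector_derivative_def)
    show "onorm (\<lambda>t. t *\<^sub>R D \<phi>) \<le> 1" if "\<phi> \<in> I" for \<phi>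
      by (rule onorm_le) (use bound[OF that] in \<open>auto intro: mult_left_le\<close>)
  qed (auto simp: I_def)
  also have "\<dots> \<le> pi" using \<alpha> by simp
  finally show ?thesis
    unfolding o_def w1 w2 \<eta>_def .
qed

text \<open>
Both sides are, up to the factor \<open>\<i>\<close>, the two terms of the derivative of the periodic function
\<open>t \<mapsto> cnj (g (cis t)) * U (cis t)\<close>, which integrates to zero over a period.
\<close>

lemma circle_integration_by_parts:
  assumes "cball 0 1 \<subseteq> S"
    and g: "\<And>w. w \<in> S \<Longrightarrow> (g has_field_derivative g' w) (at w)"
    and U: "\<And>w. w \<in> S \<Longrightarrow> (U has_field_derivative U' w) (at w)"
    and cont: "continuous_on (sphere 0 1) g'" "continuous_on (sphere 0 1) U'"
  shows "(LINT \<zeta>|circle_measure. cnj (g \<zeta>) * (\<zeta> * U' \<zeta>)) =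
         (LINT \<zeta>|circle_measure. cnj (\<zeta> * g' \<zeta>) * U \<zeta>)"
proof -
  have contS: "continuous_on (sphere 0 1) g" "continuous_on (sphere 0 1) U"
    using assms(1) by (auto intro!: continuous_at_imp_continuous_on DERIV_isCont[OF g] DERIV_isCont[OF U])
  define F where "F = (\<lambda>\<zeta>. cnj (g \<zeta>) * (\<zeta> * U' \<zeta>) - cnj (\<zeta> * g' \<zeta>) * U \<zeta>)"
  have cF: "continuous_on (sphere 0 1) F"
    unfolding F_def by (intro continuous_intros contS cont)
  have dg: "((\<lambda>t. cnj (g (cis t))) has_vector_derivative cnj (\<i> * cis t * g' (cis t))) (at t within X)" for t X
  proof -
    have "((g \<circ> cis) has_vector_derivative (\<i> * cis t) * g' (cis t)) (at t within X)"
      by (rule field_vector_diff_chain_within[OF has_vector_derivative_cis has_field_derivative_at_within[OF g]])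
         (use assms(1) in auto)
    then show ?thesis by (intro has_vector_derivative_cnj) (simp add: o_def)
  qed
  have dU: "((\<lambda>t. U (cis t)) has_vector_derivative (\<i> * cis t * U' (cis t))) (at t within X)" for t X
  proof -
    have "((U \<circ> cis) has_vector_derivative (\<i> * cis t) * U' (cis t)) (at t within X)"
      by (rule field_vector_diff_chain_within[OF has_vector_derivative_cis has_field_derivative_at_within[OF U]])
         (use assms(1) in auto)
    then show ?thesis by (simp add: o_def)
  qed
  have "((\<lambda>t. \<i> * F (cis t)) has_integral
      cnj (g (cis (2*pi))) * U (cis (2*pi)) - cnj (g (cis 0)) * U (cis 0)) {0..2*pi}"
  proof (rule fundamental_theorem_of_calculus)
    fix t assume "t \<in> {0..2*pi}"
    show "((\<lambda>t. cnj (g (cis t)) * U (cis t)) has_vector_derivative \<i> * F (cis t)) (at t within {0..2*pi})"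
      by (rule has_vector_derivative_eq_rhs[OF has_vector_derivative_mult[OF dg dU]])
         (simp add: F_def algebra_simps)
  qed auto
  then have "((\<lambda>t. F (cis t)) has_integral 0) {0..2*pi}"
    using has_integral_mult_right[of "\<lambda>t. \<i> * F (cis t)" 0 _ "-\<i>"] by (simp flip: mult.assoc)
  then have "(LINT \<zeta>|circle_measure. F \<zeta>) = 0"
    unfolding circle_integral_eq[OF cF] by (simp add: integral_unique)
  then show ?thesis
    unfolding F_def
    by (subst (asm) Bochner_Integration.integral_diff)
       (auto intro!: integrable_circle continuous_intros contS cont)
qed

text \<open>
The inequality itself, for functions that are smooth up to the boundary. The Poisson part of the
kernel contributes at most \<open>sup |f|\<close>. In the other part \<open>h\<close> is multiplied by a kernel with pole outside
the disc; integrating by parts moves the derivative to \<open>f\<close> and leaves a primitive \<open>U\<close> of that product.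
This \<open>U\<close> alone has a logarithmic singularity near \<open>z\<close> as \<open>z\<close> approaches the circle. However, the reflected
function \<open>\<zeta> \<mapsto> U (\<eta>\<^sup>2 * cnj \<zeta>)\<close> is antiholomorphic, hence orthogonal to \<open>\<zeta> * deriv f \<zeta>\<close>, and may be subtracted
for free; the difference is bounded by \<open>\<pi>\<close>.
\<close>

lemma toeplitz_bound_smooth:
  assumes R: "1 < R" and f: "f holomorphic_on ball 0 R" and h: "h holomorphic_on ball 0 R"
    and fM: "\<And>w. norm w \<le> 1 \<Longrightarrow> norm (f w) \<le> M" and h1: "\<And>w. norm w \<le> 1 \<Longrightarrow> norm (h w) \<le> 1"
    and z: "norm z < 1"
  shows "norm (LINT \<zeta>|circle_measure. cnj (f \<zeta>) * h \<zeta> / (1 - cnj \<zeta> * z))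
    \<le> M + pi * (LINT \<zeta>|circle_measure. norm (deriv f \<zeta>))"
proof -
  have sub: "cball 0 1 \<subseteq> ball (0::complex) R" "sphere 0 1 \<subseteq> ball (0::complex) R"
      "ball 0 1 \<subseteq> ball (0::complex) R"
    using R by auto
  have cf: "continuous_on (sphere 0 1) f" and ch: "continuous_on (sphere 0 1) h"
    using f h sub by (auto intro: holomorphic_on_imp_continuous_on continuous_on_subset)
  have df: "deriv f holomorphic_on ball 0 R" by (rule holomorphic_deriv[OF f]) auto
  then have cdf: "continuous_on (sphere 0 1) (deriv f)"
    using sub by (auto intro: holomorphic_on_imp_continuous_on continuous_on_subset)
  \<comment> \<open>a disc beyond the unit circle that avoids the outer pole \<open>1 / cnj z\<close>\<close>
  obtain R' where R': "1 < R'" "R' \<le> R" and nzR: "\<And>w. norm w < R' \<Longrightarrow> 1 - w * cnj z \<noteq> 0"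
  proof (cases "z = 0")
    case True
    then show ?thesis using that[of R] R by auto
  next
    case False
    have "1 < min R (1 / norm z)" using R z False by (auto simp: field_simps)
    moreover have "1 - w * cnj z \<noteq> 0" if "norm w < min R (1 / norm z)" for w
    proof
      assume "1 - w * cnj z = 0"
      then have "norm (w * cnj z) = 1" by (metis eq_iff_diff_eq_0 norm_one)
      then show False using that False by (simp add: norm_mult field_simps)
    qed
    ultimately show ?thesis using that[of "min R (1 / norm z)"] by auto
  qed
  have subR': "cball 0 1 \<subseteq> ball (0::complex) R'" "sphere 0 1 \<subseteq> ball (0::complex) R'"
      "ball 0 1 \<subseteq> ball (0::complex) R'" "ball 0 R' \<subseteq> ball (0::complex) R"
    using R' by auto
  define k where "k = (\<lambda>w. h w * (cnj z / (1 - w * cnj z)))"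
  have holk: "k holomorphic_on ball 0 R'"
    unfolding k_def by (intro holomorphic_intros holomorphic_on_subset[OF h] subR') (use nzR in auto)
  then have ck: "continuous_on (sphere 0 1) k"
    using subR' by (auto intro: holomorphic_on_imp_continuous_on continuous_on_subset)
  obtain U where U: "\<And>w. w \<in> ball 0 R' \<Longrightarrow> (U has_field_derivative k w) (at w)"
    using holomorphic_convex_primitive'[OF convex_ball open_ball holk] at_within_open[OF _ open_ball] by metis
  have holU: "U holomorphic_on ball 0 R'"
    using U holomorphic_on_open[OF open_ball] by blast
  then have cU: "continuous_on (sphere 0 1) U"
    using subR' by (auto intro: holomorphic_on_imp_continuous_on continuous_on_subset)
  \<comment> \<open>the axis of reflection; for \<open>z = 0\<close> the function \<open>U\<close> is constant and any axis will do\<close>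
  define \<eta> where "\<eta> = (if z = 0 then 1 else sgn (1 / cnj z))"
  have n\<eta>: "norm \<eta> = 1" by (simp add: \<eta>_def norm_sgn norm_divide sgn_divide)
  have refl: "norm (U \<zeta> - U (\<eta>\<^sup>2 * cnj \<zeta>)) \<le> pi" if "norm \<zeta> = 1" for \<zeta>
  proof (cases "z = 0")
    case True
    have "\<exists>c. \<forall>w\<in>ball 0 R'. U w = c"
    proof (rule has_field_derivative_zero_constant)
      show "(U has_field_derivative 0) (at w within ball 0 R')" if "w \<in> ball 0 R'" for w
        using has_field_derivative_at_within[OF U[OF that]] True by (simp add: k_def)
    qed auto
    then have "U \<zeta> = U (\<eta>\<^sup>2 * cnj \<zeta>)"
      using that n\<eta> R' by (auto simp: norm_mult norm_power)
    then show ?thesis by simp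
  next
    case False
    have "k w = h w / (1 / cnj z - w)" if "w \<in> ball 0 R'" for w
      using nzR[of w] that False by (simp add: k_def field_simps)
    then have "(U has_field_derivative h w / (1 / cnj z - w)) (at w)" if "w \<in> ball 0 R'" for w
      using U that by metis
    then show ?thesis
      using arc_reflection_bound[of "1 / cnj z" \<zeta> "ball 0 R'" U h] z False that subR'(1) h1
      by (simp add: \<eta>_def norm_divide field_simps)
  qed
  define P where "P = (LINT \<zeta>|circle_measure. cnj (f \<zeta>) * h \<zeta> * poisson_kernel z \<zeta>)"
  define Q where "Q = (LINT \<zeta>|circle_measure. cnj (f \<zeta>) * (\<zeta> * k \<zeta>))"
  have cUr: "continuous_on (sphere 0 1) (\<lambda>\<zeta>. U (\<eta>\<^sup>2 * cnj \<zeta>))"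
    by (rule continuous_on_compose2[OF cU]) (auto intro!: continuous_intros simp: norm_mult norm_power n\<eta>)
  have "(LINT \<zeta>|circle_measure. cnj (f \<zeta>) * h \<zeta> / (1 - cnj \<zeta> * z)) =
      (LINT \<zeta>|circle_measure. cnj (f \<zeta>) * h \<zeta> * poisson_kernel z \<zeta> - cnj (f \<zeta>) * (\<zeta> * k \<zeta>))"
    by (intro Bochner_Integration.integral_cong refl)
       (use z in \<open>auto simp: space_circle_measure poisson_kernel_split algebra_simps k_def\<close>)
  also have "\<dots> = P - Q"
    unfolding P_def Q_def
    by (intro Bochner_Integration.integral_diff integrable_circle continuous_intros cf ch ck)
       (use continuous_on_poisson_kernel[OF z] in auto)
  finally have eq: "(LINT \<zeta>|circle_measure. cnj (f \<zeta>) * h \<zeta> / (1 - cnj \<zeta> * z)) = P - Q" .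
  have "norm P \<le> (LINT \<zeta>|circle_measure. M * poisson_kernel z \<zeta>)"
    unfolding P_def
  proof (rule Bochner_Integration.integral_norm_bound_integral)
    fix \<zeta> assume "\<zeta> \<in> space circle_measure"
    then have n: "norm \<zeta> \<le> 1" by (simp add: space_circle_measure)
    have "norm (f \<zeta>) * norm (h \<zeta>) \<le> M * 1"
      using fM[OF n] h1[OF n] by (intro mult_mono) (auto intro: order_trans[OF norm_ge_zero])
    then show "norm (cnj (f \<zeta>) * h \<zeta> * poisson_kernel z \<zeta>) \<le> M * poisson_kernel z \<zeta>"
      using poisson_kernel_nonneg[OF z, of \<zeta>] by (auto simp: norm_mult intro!: mult_right_mono)
  qed (auto intro!: integrable_circle continuous_intros cf ch continuous_on_poisson_kernel z)
  then have P: "norm P \<le> M"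
    using integral_poisson_kernel[OF z] by simp
  have "Q = (LINT \<zeta>|circle_measure. cnj (\<zeta> * deriv f \<zeta>) * U \<zeta>)"
    unfolding Q_def
  proof (rule circle_integration_by_parts[OF subR'(1)])
    show "(f has_field_derivative deriv f w) (at w)" if "w \<in> ball 0 R'" for w
      using f that subR'(4) by (intro holomorphic_derivI[of f "ball 0 R"]) auto
  qed (use U cdf ck in auto)
  moreover have "(LINT \<zeta>|circle_measure. cnj (\<zeta> * deriv f \<zeta>) * U (\<eta>\<^sup>2 * cnj \<zeta>)) = 0"
  proof -
    define V where "V = (\<lambda>\<zeta>. (cnj \<circ> U \<circ> cnj) ((cnj \<eta>)\<^sup>2 * \<zeta>))"
    have "cnj ` ball 0 R' = ball (0::complex) R'"
    proof (rule antisym)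
      show "ball 0 R' \<subseteq> cnj ` ball (0::complex) R'"
      proof
        fix w :: complex assume "w \<in> ball 0 R'"
        then show "w \<in> cnj ` ball 0 R'" by (intro image_eqI[of _ _ "cnj w"]) auto
      qed
    qed auto
    then have "cnj \<circ> U \<circ> cnj holomorphic_on ball 0 R'"
      using holomorphic_on_compose_cnj_cnj[of U "ball 0 R'"] holU by simp
    moreover have "(\<lambda>\<zeta>. (cnj \<eta>)\<^sup>2 * \<zeta>) ` ball 0 R' \<subseteq> ball 0 R'"
      by (auto simp: norm_mult norm_power n\<eta>)
    moreover have "(\<lambda>\<zeta>. (cnj \<eta>)\<^sup>2 * \<zeta>) holomorphic_on ball 0 R'"
      by (intro holomorphic_intros)
    ultimately have "(cnj \<circ> U \<circ> cnj) \<circ> (\<lambda>\<zeta>. (cnj \<eta>)\<^sup>2 * \<zeta>) holomorphic_on ball 0 R'"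
      by (intro holomorphic_on_compose_gen[of _ _ "cnj \<circ> U \<circ> cnj" "ball 0 R'"])
    then have V: "V holomorphic_on ball 0 R'"
      by (simp add: V_def o_def)
    have VU: "cnj (U (\<eta>\<^sup>2 * cnj \<zeta>)) = V \<zeta>" for \<zeta> by (simp add: V_def)
    have "(\<lambda>\<zeta>. \<zeta> * deriv f \<zeta> * V \<zeta>) holomorphic_on ball 0 R'"
      by (intro holomorphic_intros V holomorphic_on_subset[OF df] subR')
    then have "(LINT \<zeta>|circle_measure. \<zeta> * deriv f \<zeta> * V \<zeta>) = 0"
      using subR' by (subst circle_mean_value) 
        (auto intro: holomorphic_on_imp_continuous_on continuous_on_subset holomorphic_on_subset)
    then have "(LINT \<zeta>|circle_measure. cnj (\<zeta> * deriv f \<zeta> * V \<zeta>)) = 0"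
      by (subst Bochner_Integration.integral_cnj) simp
    then show ?thesis by (simp flip: VU)
  qed
  ultimately have "Q = (LINT \<zeta>|circle_measure. cnj (\<zeta> * deriv f \<zeta>) * U \<zeta>) -
       (LINT \<zeta>|circle_measure. cnj (\<zeta> * deriv f \<zeta>) * U (\<eta>\<^sup>2 * cnj \<zeta>))"
    by simp
  also have "\<dots> = (LINT \<zeta>|circle_measure. cnj (\<zeta> * deriv f \<zeta>) * U \<zeta> - cnj (\<zeta> * deriv f \<zeta>) * U (\<eta>\<^sup>2 * cnj \<zeta>))"
    by (intro Bochner_Integration.integral_diff[symmetric] integrable_circle continuous_intros cdf cU cUr)
  finally have Q: "Q = \<dots>" .
  have "norm Q \<le> (LINT \<zeta>|circle_measure. pi * norm (deriv f \<zeta>))"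
    unfolding Q
  proof (rule Bochner_Integration.integral_norm_bound_integral)
    fix \<zeta> assume "\<zeta> \<in> space circle_measure"
    then have n: "norm \<zeta> = 1" by (simp add: space_circle_measure)
    have "norm (cnj (\<zeta> * deriv f \<zeta>) * U \<zeta> - cnj (\<zeta> * deriv f \<zeta>) * U (\<eta>\<^sup>2 * cnj \<zeta>))
       = norm (deriv f \<zeta>) * norm (U \<zeta> - U (\<eta>\<^sup>2 * cnj \<zeta>))"
      using n by (simp add: norm_mult flip: right_diff_distrib)
    also have "\<dots> \<le> norm (deriv f \<zeta>) * pi"
      using refl[OF n] by (intro mult_left_mono) auto
    finally show "norm (cnj (\<zeta> * deriv f \<zeta>) * U \<zeta> - cnj (\<zeta> * deriv f \<zeta>) * U (\<eta>\<^sup>2 * cnj \<zeta>)) \<le> pi * norm (deriv f \<zeta>)"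
      by (simp add: mult.commute)
  qed (auto intro!: integrable_circle continuous_intros cdf cU cUr)
  then have "norm Q \<le> pi * (LINT \<zeta>|circle_measure. norm (deriv f \<zeta>))" by simp
  with P show ?thesis unfolding eq using norm_triangle_ineq4[of P Q] by linarith
qed

section \<open>The radial maximal inequality\<close>

lemma continuous_on_cis_compose:
  fixes \<phi> :: "complex \<Rightarrow> 'a::topological_space"
  assumes "continuous_on (sphere 0 1) \<phi>"
  shows "continuous_on X (\<lambda>t. \<phi> (cis t))"
  by (rule continuous_on_compose2[OF assms]) (auto intro!: continuous_intros)

lemma circle_integral_eq_half:
  fixes \<phi> :: "complex \<Rightarrow> 'a::euclidean_space"
  assumes "continuous_on (sphere 0 1) \<phi>"
  shows "(LINT \<zeta>|circle_measure. \<phi> \<zeta>) =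
    integral {0..pi} (\<lambda>t. \<phi> (cis t) + \<phi> (cis (-t))) /\<^sub>R (2*pi)"
proof -
  define F where "F = (\<lambda>t. \<phi> (cis t))"
  have c: "continuous_on X F" "continuous_on X (\<lambda>t. F (- t))" for X
    unfolding F_def
    by (rule continuous_on_compose2[OF assms], auto intro!: continuous_intros)+
  have per: "F (- (x + 2 * pi)) = F (- x)" for x
    unfolding F_def by (simp only: cis.code cos_minus sin_minus cos_periodic sin_periodic)
  have "integral {pi..2*pi} F = integral {-(2*pi)..-pi} (\<lambda>x. F (-x))"
    by (rule Henstock_Kurzweil_Integration.integral_reflect_real[symmetric])
  also have "\<dots> = integral {0..pi} (\<lambda>x. F (-x))"
    using integral_shift_real_ivl[of 0 "2*pi" pi "\<lambda>x. F (-x)"] by (simp add: per[simplified])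
  finally have "integral {0..2*pi} F = integral {0..pi} F + integral {0..pi} (\<lambda>x. F (-x))"
    using Henstock_Kurzweil_Integration.integral_combine[of 0 pi "2*pi" F]
      integrable_continuous_interval[OF c(1)] by auto
  also have "\<dots> = integral {0..pi} (\<lambda>x. F x + F (-x))"
    by (intro Henstock_Kurzweil_Integration.integral_add[symmetric] integrable_continuous_interval c)
  finally show ?thesis
    unfolding circle_integral_eq[OF assms] F_def by simp
qed

text \<open>
The weak type estimate for the Hardy--Littlewood maximal function: by Vitali's lemma the intervals
on which the average of \<open>g\<close> exceeds \<open>L\<close> contain a disjoint subfamily whose fivefold enlargements still cover
\<open>E\<close>, and disjoint intervals can only share the total mass of \<open>g\<close>.
\<close>

lemma maximal_function_weak_type:
  fixes g :: "real \<Rightarrow> real" and a b :: real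
  assumes g: "continuous_on UNIV g" "\<And>t. 0 \<le> g t" and L: "0 < L" and B: "0 \<le> B"
  defines "E \<equiv> {t \<in> {a..b}. \<exists>s. 0 < s \<and> s \<le> B \<and> 2 * s * L < integral {t - s..t + s} g}"
  shows "\<exists>A. E \<subseteq> A \<and> A \<in> fmeasurable lborel \<and> measure lborel A \<le> 5 / L * integral {a - B..b + B} g"
proof -
  have int: "g integrable_on {x..y}" for x y
    by (intro integrable_continuous_interval continuous_on_subset[OF g(1)]) auto
  have "\<forall>t\<in>E. \<exists>s. 0 < s \<and> s \<le> B \<and> 2 * s * L < integral {t - s..t + s} g"
    by (auto simp: E_def)
  then obtain s where s: "\<And>t. t \<in> E \<Longrightarrow> 0 < s t \<and> s t \<le> B \<and> 2 * s t * L < integral {t - s t..t + s t} g"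
    by metis
  have cov: "E \<subseteq> (\<Union>t\<in>E. cball t (s t))"
    using s by force
  have sB: "\<And>t. t \<in> E \<Longrightarrow> 0 < s t \<and> s t \<le> B"
    using s by blast
  obtain C where C: "countable C" "C \<subseteq> E"
      "pairwise (\<lambda>i j. disjnt (cball i (s i)) (cball j (s j))) C" "E \<subseteq> (\<Union>i\<in>C. cball i (5 * s i))"
    by (rule Vitali_covering_lemma_cballs[OF cov sB])
  have fm: "cball i (5 * s i) \<in> fmeasurable lborel" for i :: real
    by (rule fmeasurable_compact) simp
  have bound: "measure lborel (\<Union>i\<in>I. cball i (5 * s i)) \<le> 5 / L * integral {a - B..b + B} g"
    if I: "I \<subseteq> C" "finite I" for I
  proof -
    have sI: "0 < s i" "s i \<le> B" "2 * s i * L < integral (cball i (s i)) g" "i \<in> {a..b}" if "i \<in> I" for i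
      using s[of i] that I C(2) unfolding cball_eq_atLeastAtMost by (auto simp: E_def)
    have un: "(g has_integral (\<Sum>i\<in>I. integral (cball i (s i)) g)) (\<Union>i\<in>I. cball i (s i))"
    proof (rule has_integral_UN)
      show "(g has_integral integral (cball i (s i)) g) (cball i (s i))" for i
        using int unfolding cball_eq_atLeastAtMost by blast
      show "pairwise (\<lambda>i i'. negligible (cball i (s i) \<inter> cball i' (s i'))) I"
      proof (rule pairwiseI)
        fix i i' assume "i \<in> I" "i' \<in> I" "i \<noteq> i'"
        then have "cball i (s i) \<inter> cball i' (s i') = {}"
          using C(3) I(1) unfolding pairwise_def disjnt_def by blast
        then show "negligible (cball i (s i) \<inter> cball i' (s i'))" by simp
      qed
    qed fact
    have "measure lborel (\<Union>i\<in>I. cball i (5 * s i)) \<le> (\<Sum>i\<in>I. measure lborel (cball i (5 * s i)))"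
      using I by (intro measure_UNION_le) auto
    also have "\<dots> \<le> (\<Sum>i\<in>I. 5 / L * integral (cball i (s i)) g)"
    proof (rule sum_mono)
      fix i assume i: "i \<in> I"
      have "measure lborel (cball i (5 * s i)) = 10 * s i"
        unfolding cball_eq_atLeastAtMost using sI[OF i] by simp
      also have "\<dots> \<le> 5 / L * integral (cball i (s i)) g"
        using sI(3)[OF i] L by (simp add: field_simps)
      finally show "measure lborel (cball i (5 * s i)) \<le> 5 / L * integral (cball i (s i)) g" .
    qed
    also have "\<dots> = 5 / L * (\<Sum>i\<in>I. integral (cball i (s i)) g)"
      by (simp add: sum_distrib_left)
    also have "(\<Sum>i\<in>I. integral (cball i (s i)) g) = integral (\<Union>i\<in>I. cball i (s i)) g"
      using un by (simp add: integral_unique)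
    also have "integral (\<Union>i\<in>I. cball i (s i)) g \<le> integral {a - B..b + B} g"
    proof (rule integral_subset_le)
      show "(\<Union>i\<in>I. cball i (s i)) \<subseteq> {a - B..b + B}"
        using sI unfolding cball_eq_atLeastAtMost by fastforce
    qed (use un int g in \<open>auto intro: has_integral_integrable\<close>)
    finally show ?thesis using L by (simp add: mult_left_mono divide_right_mono)
  qed
  show ?thesis
    using C(4) fmeasurable_UN_bound[OF C(1) fm bound] measure_UN_bound[OF C(1) fm bound] by blast
qed

lemma poisson_kernel_cis:
  "poisson_kernel (of_real r) (cis t) = (1 - r\<^sup>2) / (1 - 2 * r * cos t + r\<^sup>2)"
proof -
  have "(norm (1 - cnj (cis t) * of_real r))\<^sup>2 = (1 - r * cos t)\<^sup>2 + (r * sin t)\<^sup>2"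
    by (simp add: cmod_power2 mult_ac)
  also have "\<dots> = 1 - 2 * r * cos t + r\<^sup>2 * ((sin t)\<^sup>2 + (cos t)\<^sup>2)"
    by (simp only: power2_eq_square ring_distribs) (simp add: algebra_simps)
  finally show ?thesis
    unfolding poisson_kernel_def by simp
qed

text \<open>
The Poisson kernel decreases away from its peak, so it is a mixture of normalized indicator
functions of centred arcs, and a bound for all centred averages of \<open>|u|\<close> is a bound for its Poisson
integral along the radius. The mixture is carried out as an integration by parts against the kernel \<open>p\<close>.
\<close>

lemma radial_bound_by_averages:
  assumes u: "continuous_on (cball 0 1) u" "u holomorphic_on ball 0 1"
    and avg: "\<And>s. 0 < s \<Longrightarrow> s \<le> pi \<Longrightarrow> integral {\<theta> - s..\<theta> + s} (\<lambda>t. norm (u (cis t))) \<le> 2 * s * L"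
    and r: "0 \<le> r" "r < 1"
  shows "norm (u (of_real r * cis \<theta>)) \<le> L"
proof -
  define g where "g = (\<lambda>t. norm (u (cis t)))"
  define d where "d = (\<lambda>t. 1 - 2 * r * cos t + r\<^sup>2)"
  define p where "p = (\<lambda>t. (1 - r\<^sup>2) / d t)"
  define p' where "p' = (\<lambda>t. - ((1 - r\<^sup>2) * (2 * r * sin t)) / (d t)\<^sup>2)"
  have dpos: "0 < d t" for t
  proof -
    have "(1 - r)\<^sup>2 \<le> d t"
      unfolding d_def using r cos_le_one[of t] mult_left_mono[of "cos t" 1 "2 * r"] by (simp add: power2_eq_square algebra_simps)
    then show ?thesis using r by (smt (verit) zero_less_power)
  qed
  have p_pos: "0 \<le> p t" for t
    unfolding p_def using dpos[of t] r by (simp add: power_le_one)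
  have dp: "(p has_real_derivative p' t) (at t within X)" for t X
    unfolding p_def p'_def using dpos[of t]
    by (auto simp: d_def power2_eq_square intro!: derivative_eq_intros)
  have p'_neg: "p' t \<le> 0" if "t \<in> {0..pi}" for t
  proof -
    have "0 \<le> (1 - r\<^sup>2) * (2 * r * sin t)"
      using that r by (intro mult_nonneg_nonneg sin_ge_zero) (auto simp: power_le_one)
    then show ?thesis unfolding p'_def by (simp add: divide_nonpos_nonneg)
  qed
  have cp: "continuous_on X p" "continuous_on X p'" for X
  proof -
    have "continuous_on X d" unfolding d_def by (intro continuous_intros)
    moreover have "d t \<noteq> 0" for t using dpos[of t] by simp
    ultimately show "continuous_on X p" "continuous_on X p'"
      unfolding p_def p'_def by (auto intro!: continuous_intros)
  qed
  have pk: "poisson_kernel (of_real r) (cis t) = p t" for t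
    by (simp add: poisson_kernel_cis p_def d_def)
  have rn: "norm (complex_of_real r) < 1" using r by simp
  have cu: "continuous_on (sphere 0 1) u" by (rule continuous_on_subset[OF u(1)]) auto
  have cg: "continuous_on UNIV g"
    unfolding g_def by (intro continuous_on_norm continuous_on_cis_compose cu)
  have cgs: "continuous_on X (\<lambda>t. g (\<theta> + t))" "continuous_on X (\<lambda>t. g (\<theta> - t))" for X
    by (rule continuous_on_compose2[OF cg], auto intro!: continuous_intros)+
  \<comment> \<open>rotating \<open>\<theta>\<close> to \<open>0\<close> makes the kernel even, which folds the integral to \<open>{0..pi}\<close>\<close>
  define v where "v = (\<lambda>w. u (cis \<theta> * w))"
  have v: "continuous_on (cball 0 1) v" "v holomorphic_on ball 0 1"
  proof -
    show "continuous_on (cball 0 1) v"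
      unfolding v_def by (rule continuous_on_compose2[OF u(1)]) (auto intro!: continuous_intros simp: norm_mult)
    have "(u \<circ> (\<lambda>w. cis \<theta> * w)) holomorphic_on ball 0 1"
      by (rule holomorphic_on_compose_gen[OF _ u(2)]) (auto intro!: holomorphic_intros simp: norm_mult)
    then show "v holomorphic_on ball 0 1" by (simp add: v_def o_def)
  qed
  have cv: "continuous_on (sphere 0 1) v" by (rule continuous_on_subset[OF v(1)]) auto
  have nv: "norm (v (cis t)) = g (\<theta> + t)" "norm (v (cis (-t))) = g (\<theta> - t)" for t
    by (simp_all add: v_def g_def cis_mult)
  have pm: "p (-t) = p t" for t by (simp add: p_def d_def)
  have "u (of_real r * cis \<theta>) = v (of_real r)" by (simp add: v_def mult.commute)
  also have "\<dots> = (LINT \<zeta>|circle_measure. v \<zeta> * poisson_kernel (of_real r) \<zeta>)"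
    by (rule poisson_formula[OF v rn, symmetric])
  finally have "norm (u (of_real r * cis \<theta>)) \<le> (LINT \<zeta>|circle_measure. norm (v \<zeta> * poisson_kernel (of_real r) \<zeta>))"
    by (simp only: integral_norm_bound)
  also have "\<dots> = (LINT \<zeta>|circle_measure. norm (v \<zeta>) * poisson_kernel (of_real r) \<zeta>)"
    using poisson_kernel_nonneg[OF rn] by (simp add: norm_mult)
  also have "\<dots> = integral {0..pi} (\<lambda>t. norm (v (cis t)) * poisson_kernel (of_real r) (cis t) +
      norm (v (cis (-t))) * poisson_kernel (of_real r) (cis (-t))) /\<^sub>R (2*pi)"
    by (rule circle_integral_eq_half) (intro continuous_intros cv continuous_on_poisson_kernel rn)
  also have "\<dots> = integral {0..pi} (\<lambda>t. (g (\<theta> + t) + g (\<theta> - t)) * p t) /\<^sub>R (2*pi)"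
    by (simp only: nv pk pm distrib_right add_uminus_conv_diff)
  finally have main: "norm (u (of_real r * cis \<theta>)) \<le> integral {0..pi} (\<lambda>t. (g (\<theta> + t) + g (\<theta> - t)) * p t) / (2*pi)"
    unfolding real_scaleR_def by (simp only: divide_inverse mult.commute)
  have "(LINT \<zeta>|circle_measure. poisson_kernel (of_real r) \<zeta>) =
      integral {0..pi} (\<lambda>t. poisson_kernel (of_real r) (cis t) + poisson_kernel (of_real r) (cis (-t))) /\<^sub>R (2*pi)"
    by (rule circle_integral_eq_half) (intro continuous_on_poisson_kernel rn)
  also have "\<dots> = integral {0..pi} (\<lambda>t. 2 * p t) /\<^sub>R (2*pi)"
    by (simp only: pk pm mult_2)
  finally have "1 = integral {0..pi} (\<lambda>t. 2 * p t) /\<^sub>R (2*pi)"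
    unfolding integral_poisson_kernel[OF rn] .
  then have intp: "integral {0..pi} p = pi"
    by (simp add: field_simps)
  \<comment> \<open>an antiderivative of \<open>g\<close> turns the hypothesis on averages into \<open>D \<ge> 0\<close>; as \<open>pi < 4\<close>, the
    radius \<open>4\<close> leaves room for two-sided derivatives\<close>
  obtain A where A: "\<And>x. x \<in> {\<theta> - 4..\<theta> + 4} \<Longrightarrow> (A has_vector_derivative g x) (at x within {\<theta> - 4..\<theta> + 4})"
    using antiderivative_continuous[of "\<theta> - 4" "\<theta> + 4" g] continuous_on_subset[OF cg] by blast
  have dA: "(A has_real_derivative g x) (at x within X)" if "x \<in> {\<theta> - 4<..<\<theta> + 4}" for x X
    using A[of x] that by (auto simp: at_within_Icc_at has_real_derivative_iff_has_vector_derivative 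
        intro: has_vector_derivative_at_within)
  define D where "D = (\<lambda>s. 2 * L * s - (A (\<theta> + s) - A (\<theta> - s)))"
  define D' where "D' = (\<lambda>s. 2 * L - (g (\<theta> + s) + g (\<theta> - s)))"
  have Dpos: "0 \<le> D s" if "s \<in> {0..pi}" for s
  proof (cases "s = 0")
    case False
    have "(g has_integral (A (\<theta> + s) - A (\<theta> - s))) {\<theta> - s..\<theta> + s}"
      using that pi_less_4
      by (intro fundamental_theorem_of_calculus dA[unfolded has_real_derivative_iff_has_vector_derivative]) auto
    then show ?thesis
      using avg[of s] that False unfolding D_def g_def by (simp add: integral_unique mult_ac)
  qed (simp add: D_def)
  have dD: "(D has_real_derivative D' s) (at s within {0..pi})" if "s \<in> {0..pi}" for s
  proof -
    have "((\<lambda>s. A (\<theta> + s)) has_real_derivative g (\<theta> + s)) (at s within {0..pi})"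
    proof -
      have "((\<lambda>s. A (\<theta> + s)) has_real_derivative g (\<theta> + s) * 1) (at s within {0..pi})"
        by (rule DERIV_chain2[where f = A and g = "\<lambda>s. \<theta> + s"], rule dA)
           (use that pi_less_4 in \<open>auto intro!: derivative_eq_intros\<close>)
      then show ?thesis by simp
    qed
    moreover have "((\<lambda>s. A (\<theta> - s)) has_real_derivative - g (\<theta> - s)) (at s within {0..pi})"
    proof -
      have "((\<lambda>s. A (\<theta> - s)) has_real_derivative g (\<theta> - s) * (-1)) (at s within {0..pi})"
        by (rule DERIV_chain2[where f = A and g = "\<lambda>s. \<theta> - s"], rule dA)
           (use that pi_less_4 in \<open>auto intro!: derivative_eq_intros\<close>)
      then show ?thesis by simp
    qed
    ultimately show ?thesis
      unfolding D_def D'_def by (auto intro!: derivative_eq_intros)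
  qed
  have cD': "continuous_on X D'" for X
    unfolding D'_def by (intro continuous_intros cgs)
  have cD: "continuous_on {0..pi} D"
    using dD by (rule DERIV_continuous_on)
  \<comment> \<open>since \<open>D 0 = 0\<close>, \<open>D \<ge> 0\<close> and \<open>p' \<le> 0\<close>, integrating by parts gives a nonnegative integral of \<open>D' * p\<close>\<close>
  have "((\<lambda>s. D' s * p s + p' s * D s) has_integral D pi * p pi - D 0 * p 0) {0..pi}"
    by (rule fundamental_theorem_of_calculus)
       (auto intro!: derivative_eq_intros dD dp simp flip: has_real_derivative_iff_has_vector_derivative)
  then have "integral {0..pi} (\<lambda>s. D' s * p s + p' s * D s) = D pi * p pi"
    by (simp add: integral_unique D_def)
  moreover have "integral {0..pi} (\<lambda>s. D' s * p s + p' s * D s) =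
      integral {0..pi} (\<lambda>s. D' s * p s) + integral {0..pi} (\<lambda>s. p' s * D s)"
    by (intro Henstock_Kurzweil_Integration.integral_add integrable_continuous_interval continuous_intros cD cD' cp)
  moreover have "integral {0..pi} (\<lambda>s. p' s * D s) \<le> 0"
  proof -
    have "integral {0..pi} (\<lambda>s. p' s * D s) \<le> integral {0..pi} (\<lambda>s. 0)"
      by (intro integral_le integrable_continuous_interval continuous_intros cD cp)
         (use p'_neg Dpos in \<open>auto intro!: mult_nonpos_nonneg\<close>)
    then show ?thesis by simp
  qed
  moreover have "0 \<le> D pi * p pi"
    by (intro mult_nonneg_nonneg Dpos p_pos) auto
  ultimately have "0 \<le> integral {0..pi} (\<lambda>s. D' s * p s)"
    by linarith
  also have "integral {0..pi} (\<lambda>s. D' s * p s) = integral {0..pi} (\<lambda>s. 2 * L * p s - (g (\<theta> + s) + g (\<theta> - s)) * p s)"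
    by (simp add: D'_def left_diff_distrib)
  also have "\<dots> = integral {0..pi} (\<lambda>s. 2 * L * p s) - integral {0..pi} (\<lambda>s. (g (\<theta> + s) + g (\<theta> - s)) * p s)"
    by (intro Henstock_Kurzweil_Integration.integral_diff integrable_continuous_interval continuous_intros cgs cp)
  also have "integral {0..pi} (\<lambda>s. 2 * L * p s) = 2 * L * pi"
    by (simp add: intp)
  finally have "integral {0..pi} (\<lambda>s. (g (\<theta> + s) + g (\<theta> - s)) * p s) / (2 * pi) \<le> L"
    by (simp add: field_simps)
  with main show ?thesis by linarith
qed

text \<open>
  The superlevel set of the radial maximal function of \<open>u\<close>.
\<close>

definition radially_above :: "(complex \<Rightarrow> complex) \<Rightarrow> real \<Rightarrow> complex set" where
  "radially_above u L = {\<zeta> \<in> sphere 0 1. \<exists>r\<in>{0..<1}. L < norm (u (of_real r * \<zeta>))}"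

lemma sets_radially_above:
  assumes "continuous_on (ball 0 1) u"
  shows "radially_above u L \<in> sets circle_measure"
proof -
  have "openin (top_of_set (sphere 0 1)) (\<Union>r\<in>{0..<1}. sphere 0 1 \<inter> (\<lambda>\<zeta>. norm (u (of_real r * \<zeta>))) -` {L<..})"
  proof (rule openin_Union, clarify)
    fix r :: real assume "r \<in> {0..<1}"
    then show "openin (top_of_set (sphere 0 1)) (sphere 0 1 \<inter> (\<lambda>\<zeta>. norm (u (of_real r * \<zeta>))) -` {L<..})"
      by (intro continuous_openin_preimage_gen open_greaterThan continuous_on_norm continuous_on_compose2[OF assms])
         (auto intro!: continuous_intros simp: norm_mult)
  qed
  also have "(\<Union>r\<in>{0..<1}. sphere 0 1 \<inter> (\<lambda>\<zeta>. norm (u (of_real r * \<zeta>))) -` {L<..}) = radially_above u L"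
    by (auto simp: radially_above_def)
  finally obtain T where "open T" "radially_above u L = sphere 0 1 \<inter> T"
    by (auto simp: openin_open)
  then show ?thesis
    by (auto simp: sets_circle_measure sets_restrict_space)
qed

text \<open>
Windows of radius at most one period, centred in \<open>{0..2*pi}\<close>, stay within three periods.
\<close>

lemma integral_three_periods:
  fixes g :: "real \<Rightarrow> real"
  assumes "continuous_on UNIV g" and per: "\<And>t. g (t + 2*pi) = g t"
  shows "integral {- (2*pi)..4*pi} g = 3 * integral {0..2*pi} g"
proof -
  have int: "g integrable_on {x..y}" for x y
    by (intro integrable_continuous_interval continuous_on_subset[OF assms(1)]) auto
  have 1: "integral {-(2*pi)..0} g = integral {0..2*pi} g"
    using integral_shift_real_ivl[of 0 "2*pi" "2*pi" g] by (simp add: per)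
  have 2: "integral {2*pi..4*pi} g = integral {0..2*pi} g"
    using integral_shift_real_ivl[of "2*pi" "2*pi" "4*pi" g] by (simp add: per)
  have "integral {- (2*pi)..4*pi} g = integral {-(2*pi)..0} g + (integral {0..2*pi} g + integral {2*pi..4*pi} g)"
    using Henstock_Kurzweil_Integration.integral_combine[of "-(2*pi)" 0 "4*pi" g]
      Henstock_Kurzweil_Integration.integral_combine[of 0 "2*pi" "4*pi" g] int by simp
  then show ?thesis using 1 2 by simp
qed

lemma radial_maximal_inequality:
  assumes u: "continuous_on (cball 0 1) u" "u holomorphic_on ball 0 1" and L: "0 < L"
  shows "measure circle_measure (radially_above u L) \<le> 15 / L * (LINT \<zeta>|circle_measure. norm (u \<zeta>))"
proof -
  define g where "g = (\<lambda>t. norm (u (cis t)))"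
  have cu: "continuous_on (sphere 0 1) u" by (rule continuous_on_subset[OF u(1)]) auto
  have cg: "continuous_on UNIV g"
    unfolding g_def by (intro continuous_on_norm continuous_on_cis_compose cu)
  have S: "radially_above u L \<in> sets circle_measure"
    by (intro sets_radially_above continuous_on_subset[OF u(1)]) auto
  obtain A where A: "{t \<in> {0..2*pi}. \<exists>s. 0 < s \<and> s \<le> 2 * pi \<and> 2 * s * L < integral {t - s..t + s} g} \<subseteq> A"
      "A \<in> fmeasurable lborel" "measure lborel A \<le> 5 / L * integral {0 - 2 * pi..2 * pi + 2 * pi} g"
    using maximal_function_weak_type[OF cg _ L, of "2*pi" 0 "2*pi"] by (auto simp: g_def)
  have sub: "{0..2*pi} \<inter> cis -` radially_above u L \<subseteq> A"
  proof
    fix t assume t: "t \<in> {0..2*pi} \<inter> cis -` radially_above u L"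
    then obtain r where r: "0 \<le> r" "r < 1" "L < norm (u (of_real r * cis t))"
      by (auto simp: radially_above_def)
    have "\<exists>s. 0 < s \<and> s \<le> pi \<and> 2 * s * L < integral {t - s..t + s} g"
      using radial_bound_by_averages[OF u, of t L r] r unfolding g_def by (meson linorder_not_le)
    then have "\<exists>s. 0 < s \<and> s \<le> 2 * pi \<and> 2 * s * L < integral {t - s..t + s} g"
      by (metis mult_2 add_increasing2 pi_ge_zero order_trans le_add_same_cancel1)
    then show "t \<in> A" using A(1) t by auto
  qed
  have "measure circle_measure (radially_above u L) =
      measure (uniform_measure lborel {0..2*pi}) (cis -` radially_above u L)"
    using S cis_measurable_circle unfolding sets_circle_measure circle_measure_def
    by (subst measure_distr) auto
  also have "\<dots> = measure lborel ({0..2*pi} \<inter> cis -` radially_above u L) / (2*pi)"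
  proof -
    have "cis -` radially_above u L \<in> sets lborel"
      using measurable_sets[OF cis_measurable_circle S[unfolded sets_circle_measure]] by simp
    then show ?thesis by (subst measure_uniform_measure) (auto simp: emeasure_lborel_Icc_eq)
  qed
  also have "\<dots> \<le> measure lborel A / (2*pi)"
  proof (intro divide_right_mono measure_mono_fmeasurable sub A)
    show "{0..2*pi} \<inter> cis -` radially_above u L \<in> sets lborel"
      using measurable_sets[OF cis_measurable_circle S[unfolded sets_circle_measure]] by simp
  qed auto
  also have "\<dots> \<le> 5 / L * (3 * integral {0..2*pi} g) / (2*pi)"
    using A(3) integral_three_periods[OF cg] by (intro divide_right_mono) (auto simp: g_def cis.code)
  also have "\<dots> = 15 / L * (integral {0..2*pi} g /\<^sub>R (2*pi))"
    by (simp add: field_simps)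
  also have "integral {0..2*pi} g /\<^sub>R (2*pi) = (LINT \<zeta>|circle_measure. norm (u \<zeta>))"
    unfolding g_def by (rule circle_integral_eq[symmetric]) (intro continuous_intros cu)
  finally show ?thesis .
qed

section \<open>Radial limits of bounded holomorphic functions\<close>

lemma circle_moment: "(LINT \<zeta>|circle_measure. \<zeta> ^ m * cnj (\<zeta> ^ n)) = (if m = n then 1 else 0)"
proof -
  have le: "(LINT \<zeta>|circle_measure. \<zeta> ^ k * cnj (\<zeta> ^ l)) = (if k = l then 1 else 0)" if "l \<le> k" for k l
  proof -
    have "\<zeta> ^ k * cnj (\<zeta> ^ l) = \<zeta> ^ (k - l)" if "norm \<zeta> = 1" for \<zeta>
    proof -
      have "\<zeta> ^ l * cnj (\<zeta> ^ l) = 1"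
        using that by (simp only: complex_norm_square[symmetric] norm_power) simp
      moreover have "\<zeta> ^ k = \<zeta> ^ (k - l) * \<zeta> ^ l"
        using \<open>l \<le> k\<close> by (simp flip: power_add)
      ultimately show ?thesis by (metis mult.assoc mult_1_right)
    qed
    then have "(LINT \<zeta>|circle_measure. \<zeta> ^ k * cnj (\<zeta> ^ l)) = (LINT \<zeta>|circle_measure. \<zeta> ^ (k - l))"
      by (intro Bochner_Integration.integral_cong) (auto simp: space_circle_measure)
    also have "\<dots> = 0 ^ (k - l)"
      by (rule circle_mean_value) (auto intro!: continuous_intros holomorphic_intros)
    finally show ?thesis using that by (auto simp: power_0_left)
  qed
  show ?thesis
  proof (cases "n \<le> m")
    case False
    have "(LINT \<zeta>|circle_measure. \<zeta> ^ m * cnj (\<zeta> ^ n)) = (LINT \<zeta>|circle_measure. cnj (\<zeta> ^ n * cnj (\<zeta> ^ m)))"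
      by (simp add: mult.commute)
    also have "\<dots> = cnj (LINT \<zeta>|circle_measure. \<zeta> ^ n * cnj (\<zeta> ^ m))"
      by (rule Bochner_Integration.integral_cnj)
    finally show ?thesis using le[of m n] False by simp
  qed (rule le)
qed

text \<open>
Termwise integration, justified by absolute summability of the coefficients on the circle.
\<close>

lemma circle_integral_power_series:
  fixes a :: "nat \<Rightarrow> complex"
  assumes a: "summable (\<lambda>n. norm (a n))" and G: "continuous_on (sphere 0 1) G"
    and v: "\<And>\<zeta>. norm \<zeta> = 1 \<Longrightarrow> (\<lambda>n. a n * \<zeta> ^ n) sums v \<zeta>"
  shows "(\<lambda>n. a n * (LINT \<zeta>|circle_measure. \<zeta> ^ n * G \<zeta>)) sums (LINT \<zeta>|circle_measure. v \<zeta> * G \<zeta>)"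
proof -
  have int: "integrable circle_measure (\<lambda>\<zeta>. norm (G \<zeta>))"
    by (intro integrable_circle continuous_intros G)
  have nrm: "(LINT \<zeta>|circle_measure. norm (a n * (\<zeta> ^ n * G \<zeta>))) = norm (a n) * (LINT \<zeta>|circle_measure. norm (G \<zeta>))" for n
  proof -
    have "(LINT \<zeta>|circle_measure. norm (a n * (\<zeta> ^ n * G \<zeta>))) = (LINT \<zeta>|circle_measure. norm (a n) * norm (G \<zeta>))"
      by (intro Bochner_Integration.integral_cong) (auto simp: space_circle_measure norm_mult norm_power)
    then show ?thesis by simp
  qed
  have "(\<lambda>n. LINT \<zeta>|circle_measure. a n * (\<zeta> ^ n * G \<zeta>)) sums (LINT \<zeta>|circle_measure. (\<Sum>n. a n * (\<zeta> ^ n * G \<zeta>)))"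
  proof (rule sums_integral)
    show "integrable circle_measure (\<lambda>\<zeta>. a n * (\<zeta> ^ n * G \<zeta>))" for n
      by (intro integrable_circle continuous_intros G)
    show "AE \<zeta> in circle_measure. summable (\<lambda>n. norm (a n * (\<zeta> ^ n * G \<zeta>)))"
    proof (rule AE_I2)
      fix \<zeta> assume "\<zeta> \<in> space circle_measure"
      then show "summable (\<lambda>n. norm (a n * (\<zeta> ^ n * G \<zeta>)))"
        using summable_mult2[OF a, of "norm (G \<zeta>)"] by (simp add: space_circle_measure norm_mult norm_power)
    qed
    show "summable (\<lambda>n. LINT \<zeta>|circle_measure. norm (a n * (\<zeta> ^ n * G \<zeta>)))"
      unfolding nrm by (rule summable_mult2[OF a])
  qed
  also have "(\<lambda>n. LINT \<zeta>|circle_measure. a n * (\<zeta> ^ n * G \<zeta>)) = (\<lambda>n. a n * (LINT \<zeta>|circle_measure. \<zeta> ^ n * G \<zeta>))"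
    by simp
  also have "(LINT \<zeta>|circle_measure. (\<Sum>n. a n * (\<zeta> ^ n * G \<zeta>))) = (LINT \<zeta>|circle_measure. v \<zeta> * G \<zeta>)"
  proof (rule Bochner_Integration.integral_cong)
    fix \<zeta> assume "\<zeta> \<in> space circle_measure"
    then have "(\<lambda>n. a n * \<zeta> ^ n * G \<zeta>) sums (v \<zeta> * G \<zeta>)"
      by (intro sums_mult2 v) (simp add: space_circle_measure)
    then show "(\<Sum>n. a n * (\<zeta> ^ n * G \<zeta>)) = v \<zeta> * G \<zeta>"
      by (simp add: sums_iff mult.assoc)
  qed simp
  finally show ?thesis .
qed

lemma Parseval_circle:
  fixes c :: "nat \<Rightarrow> complex"
  assumes v: "\<And>z. norm z < 1 \<Longrightarrow> (\<lambda>n. c n * z ^ n) sums v z"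
    and cont: "continuous_on (ball 0 1) v" and \<rho>: "0 \<le> \<rho>" "\<rho> < 1"
  shows "(\<lambda>n. (norm (c n))\<^sup>2 * \<rho> ^ (2 * n)) sums (LINT \<zeta>|circle_measure. (norm (v (of_real \<rho> * \<zeta>)))\<^sup>2)"
proof -
  define a where "a = (\<lambda>n. c n * of_real \<rho> ^ n)"
  define w where "w = (\<lambda>\<zeta>. v (of_real \<rho> * \<zeta>))"
  have w: "(\<lambda>n. a n * \<zeta> ^ n) sums w \<zeta>" if "norm \<zeta> = 1" for \<zeta>
    using v[of "of_real \<rho> * \<zeta>"] that \<rho> by (simp add: norm_mult a_def w_def power_mult_distrib mult.assoc)
  have cw: "continuous_on (sphere 0 1) w"
    unfolding w_def by (rule continuous_on_compose2[OF cont]) (use \<rho> in \<open>auto intro!: continuous_intros simp: norm_mult\<close>)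
  have a: "summable (\<lambda>n. norm (a n))"
  proof -
    have "summable (\<lambda>n. c n * of_real ((1 + \<rho>) / 2) ^ n)"
      using v[of "of_real ((1 + \<rho>) / 2)"] \<rho> by (auto simp: sums_iff simp del: of_real_divide of_real_add)
    then show ?thesis
      unfolding a_def by (rule powser_insidea) (use \<rho> in \<open>simp del: of_real_divide of_real_add\<close>)
  qed
  have coef: "(LINT \<zeta>|circle_measure. \<zeta> ^ n * cnj (w \<zeta>)) = cnj (a n)" for n
  proof -
    have "(\<lambda>m. a m * (LINT \<zeta>|circle_measure. \<zeta> ^ m * cnj (\<zeta> ^ n))) sums (LINT \<zeta>|circle_measure. w \<zeta> * cnj (\<zeta> ^ n))"
      by (intro circle_integral_power_series a w continuous_intros)
    moreover have "(\<lambda>m. a m * (LINT \<zeta>|circle_measure. \<zeta> ^ m * cnj (\<zeta> ^ n))) = (\<lambda>m. if m = n then a m else 0)"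
      unfolding circle_moment by auto
    ultimately have "(LINT \<zeta>|circle_measure. w \<zeta> * cnj (\<zeta> ^ n)) = a n"
      using sums_single[of n a] by (metis sums_unique2)
    moreover have "(LINT \<zeta>|circle_measure. \<zeta> ^ n * cnj (w \<zeta>)) = cnj (LINT \<zeta>|circle_measure. w \<zeta> * cnj (\<zeta> ^ n))"
      by (subst Bochner_Integration.integral_cnj[symmetric]) (simp add: mult.commute)
    ultimately show ?thesis by simp
  qed
  have "(\<lambda>n. a n * (LINT \<zeta>|circle_measure. \<zeta> ^ n * cnj (w \<zeta>))) sums (LINT \<zeta>|circle_measure. w \<zeta> * cnj (w \<zeta>))"
    by (intro circle_integral_power_series a w continuous_intros cw)
  then have "(\<lambda>n. a n * cnj (a n)) sums (LINT \<zeta>|circle_measure. w \<zeta> * cnj (w \<zeta>))"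
    by (simp only: coef)
  then have "(\<lambda>n. complex_of_real ((norm (a n))\<^sup>2)) sums complex_of_real (LINT \<zeta>|circle_measure. (norm (w \<zeta>))\<^sup>2)"
    by (simp only: complex_norm_square[symmetric] integral_complex_of_real)
  then have "(\<lambda>n. (norm (a n))\<^sup>2) sums (LINT \<zeta>|circle_measure. (norm (w \<zeta>))\<^sup>2)"
    by (simp only: sums_of_real_iff)
  moreover have "(norm (a n))\<^sup>2 = (norm (c n))\<^sup>2 * \<rho> ^ (2 * n)" for n
    using \<rho> by (simp add: a_def norm_mult norm_power power_mult_distrib power_even_eq)
  ultimately show ?thesis by (simp add: w_def)
qed

definition radius_seq :: "nat \<Rightarrow> real" where
  "radius_seq n = 1 - inverse (real n + 2)"

lemma radius_seq: "0 < radius_seq n" "radius_seq n < 1"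
  by (auto simp: radius_seq_def field_simps)

lemma radius_seq_mono: "m \<le> n \<Longrightarrow> radius_seq m \<le> radius_seq n"
  by (auto simp: radius_seq_def le_imp_inverse_le)

lemma radius_seq_LIMSEQ: "radius_seq \<longlonglongrightarrow> 1"
  unfolding radius_seq_def by real_asymp

lemma filterlim_radius_seq: "filterlim radius_seq (at_left 1) sequentially"
  unfolding filterlim_at using radius_seq_LIMSEQ radius_seq by (auto intro!: always_eventually simp: less_imp_neq)

text \<open>
By Parseval the partial sums of the squared coefficients, damped by powers of the radius, never
exceed \<open>B\<^sup>2\<close>; the damping disappears as the radius tends to one.
\<close>

lemma coefficients_square_summable:
  assumes h: "h holomorphic_on ball 0 1" and B: "\<And>z. norm z < 1 \<Longrightarrow> norm (h z) \<le> B"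
  obtains c where "\<And>z. norm z < 1 \<Longrightarrow> (\<lambda>n. c n * z ^ n) sums h z" "summable (\<lambda>n. (norm (c n))\<^sup>2)"
proof -
  define c where "c = (\<lambda>n. (deriv ^^ n) h 0 / fact n)"
  have c: "(\<lambda>n. c n * z ^ n) sums h z" if "norm z < 1" for z
    using holomorphic_power_series[OF h, of z] that by (simp add: c_def)
  have cont: "continuous_on (ball 0 1) h"
    using h by (rule holomorphic_on_imp_continuous_on)
  have bound: "(\<Sum>n<N. (norm (c n))\<^sup>2 * \<rho> ^ (2 * n)) \<le> B\<^sup>2" if \<rho>: "0 \<le> \<rho>" "\<rho> < 1" for N and \<rho> :: real
  proof -
    note P = Parseval_circle[OF c cont \<rho>]
    have "(\<Sum>n<N. (norm (c n))\<^sup>2 * \<rho> ^ (2 * n)) \<le> (\<Sum>n. (norm (c n))\<^sup>2 * \<rho> ^ (2 * n))"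
      by (intro sum_le_suminf sums_summable[OF P]) (use \<rho> in auto)
    also have "\<dots> = (LINT \<zeta>|circle_measure. (norm (h (of_real \<rho> * \<zeta>)))\<^sup>2)"
      using P by (simp add: sums_iff)
    also have "\<dots> \<le> (LINT \<zeta>|circle_measure. B\<^sup>2)"
    proof (rule integral_mono)
      show "integrable circle_measure (\<lambda>\<zeta>. (norm (h (of_real \<rho> * \<zeta>)))\<^sup>2)"
        by (intro integrable_circle continuous_intros continuous_on_compose2[OF cont])
           (use \<rho> in \<open>auto simp: norm_mult\<close>)
      show "(norm (h (of_real \<rho> * \<zeta>)))\<^sup>2 \<le> B\<^sup>2" if "\<zeta> \<in> space circle_measure" for \<zeta>
        using that \<rho> by (intro power_mono B) (auto simp: space_circle_measure norm_mult)
    qed simp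
    finally show ?thesis
      by (simp add: measure_def space_circle_measure emeasure_circle_measure)
  qed
  have "(\<Sum>n<N. (norm (c n))\<^sup>2) \<le> B\<^sup>2" for N
  proof (rule LIMSEQ_le_const2)
    show "(\<lambda>k. \<Sum>n<N. (norm (c n))\<^sup>2 * radius_seq k ^ (2 * n)) \<longlonglongrightarrow> (\<Sum>n<N. (norm (c n))\<^sup>2)"
    proof -
      have "(\<lambda>k. \<Sum>n<N. (norm (c n))\<^sup>2 * radius_seq k ^ (2 * n)) \<longlonglongrightarrow> (\<Sum>n<N. (norm (c n))\<^sup>2 * 1 ^ (2 * n))"
        by (intro tendsto_sum tendsto_mult tendsto_const tendsto_power radius_seq_LIMSEQ)
      then show ?thesis by simp
    qed
    show "\<exists>K. \<forall>k\<ge>K. (\<Sum>n<N. (norm (c n))\<^sup>2 * radius_seq k ^ (2 * n)) \<le> B\<^sup>2"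
      using bound radius_seq by (meson less_imp_le)
  qed
  then have "summable (\<lambda>n. (norm (c n))\<^sup>2)"
    by (intro summableI_nonneg_bounded) auto
  with c show ?thesis by (rule that)
qed

text \<open>
Boundary values are not available yet, so the approximation of \<open>h\<close> by its dilations, which are
continuous up to the circle, is measured on all circles of radius \<open>\<rho> < 1\<close> uniformly. Passing from \<open>h\<close> to
\<open>h - h (r\<^sub>j \<cdot>)\<close> multiplies the coefficient \<open>c n\<close> by \<open>1 - r\<^sub>j ^ n\<close>, and dominated convergence for series
makes the square sum small.
\<close>

lemma dilation_mean_close:
  assumes h: "h holomorphic_on ball 0 1" and B: "\<And>z. norm z < 1 \<Longrightarrow> norm (h z) \<le> B"
  obtains \<delta> :: "nat \<Rightarrow> real" where "\<delta> \<longlonglongrightarrow> 0"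
    "\<And>j \<rho>. 0 \<le> \<rho> \<Longrightarrow> \<rho> < 1 \<Longrightarrow>
       (LINT \<zeta>|circle_measure. (norm (h (of_real \<rho> * \<zeta>) - h (of_real (radius_seq j) * (of_real \<rho> * \<zeta>))))\<^sup>2) \<le> \<delta> j"
proof -
  obtain c where c: "\<And>z. norm z < 1 \<Longrightarrow> (\<lambda>n. c n * z ^ n) sums h z" and sq: "summable (\<lambda>n. (norm (c n))\<^sup>2)"
    using coefficients_square_summable[OF h B] by blast
  have cont: "continuous_on (ball 0 1) h"
    using h by (rule holomorphic_on_imp_continuous_on)
  define a where "a = (\<lambda>n j. (norm (c n) * (1 - radius_seq j ^ n))\<^sup>2)"
  have le1: "0 \<le> 1 - radius_seq j ^ n" "1 - radius_seq j ^ n \<le> 1" for j n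
    using radius_seq[of j] by (auto simp: power_le_one)
  have a_le: "norm (a n j) \<le> (norm (c n))\<^sup>2" for n j
  proof -
    have "norm (c n) * (1 - radius_seq j ^ n) \<le> norm (c n) * 1"
      using le1 by (intro mult_left_mono) auto
    then have "(norm (c n) * (1 - radius_seq j ^ n))\<^sup>2 \<le> (norm (c n))\<^sup>2"
      using le1[where j = j and n = n] by (intro power_mono) auto
    then show ?thesis by (simp add: a_def)
  qed
  have sa: "summable (\<lambda>n. a n j)" for j
    by (rule summable_comparison_test'[OF sq]) (use a_le in auto)
  define \<delta> where "\<delta> = (\<lambda>j. \<Sum>n. a n j)"
  have "\<delta> \<longlonglongrightarrow> (\<Sum>n::nat. 0::real)"
    unfolding \<delta>_def
  proof (rule tannerys_theorem[THEN conjunct2, THEN conjunct2])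
    show "(\<lambda>j. a n j) \<longlonglongrightarrow> 0" for n
      unfolding a_def by (auto intro!: tendsto_eq_intros radius_seq_LIMSEQ)
    show "\<forall>\<^sub>F (n, j) in at_top \<times>\<^sub>F sequentially. norm (a n j) \<le> (norm (c n))\<^sup>2"
      using a_le by (auto intro!: always_eventually)
  qed (use sq in auto)
  then have "\<delta> \<longlonglongrightarrow> 0" by simp
  moreover have "(LINT \<zeta>|circle_measure. (norm (h (of_real \<rho> * \<zeta>) - h (of_real (radius_seq j) * (of_real \<rho> * \<zeta>))))\<^sup>2) \<le> \<delta> j"
    if \<rho>: "0 \<le> \<rho>" "\<rho> < 1" for j and \<rho> :: real
  proof -
    define s where "s = radius_seq j"
    have s: "0 < s" "s < 1" using radius_seq by (auto simp: s_def)
    define v where "v = (\<lambda>z. h z - h (of_real s * z))"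
    have in_ball: "norm (of_real s * z) < 1" if "norm z < 1" for z :: complex
    proof -
      have "s * norm z \<le> 1 * norm z" using s by (intro mult_right_mono) auto
      then show ?thesis using that s by (simp add: norm_mult)
    qed
    have v: "(\<lambda>n. (c n * of_real (1 - s ^ n)) * z ^ n) sums v z" if "norm z < 1" for z
      using sums_diff[OF c[OF that] c[OF in_ball[OF that]]] by (simp add: v_def algebra_simps power_mult_distrib)
    have "continuous_on (ball 0 1) (\<lambda>z. h (of_real s * z))"
      by (rule continuous_on_compose2[OF cont]) (use in_ball in \<open>auto intro!: continuous_intros\<close>)
    then have cv: "continuous_on (ball 0 1) v"
      unfolding v_def by (intro continuous_intros cont)
    note P = Parseval_circle[OF v cv \<rho>]
    have "(LINT \<zeta>|circle_measure. (norm (v (of_real \<rho> * \<zeta>)))\<^sup>2) = (\<Sum>n. (norm (c n * of_real (1 - s ^ n)))\<^sup>2 * \<rho> ^ (2 * n))"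
      using P by (simp add: sums_iff)
    also have "\<dots> \<le> \<delta> j"
      unfolding \<delta>_def
    proof (intro suminf_le sums_summable[OF P] sa)
      fix n
      have "(norm (c n * of_real (1 - s ^ n)))\<^sup>2 = a n j"
        using le1[where j = j and n = n] unfolding a_def s_def norm_mult norm_of_real by simp
      moreover have "a n j * \<rho> ^ (2 * n) \<le> a n j * 1"
        using \<rho> by (intro mult_left_mono power_le_one) (auto simp: a_def)
      ultimately show "(norm (c n * of_real (1 - s ^ n)))\<^sup>2 * \<rho> ^ (2 * n) \<le> a n j" by simp
    qed
    finally show ?thesis by (simp add: v_def s_def)
  qed
  ultimately show ?thesis by (rule that)
qed

text \<open>
The maximal inequality for the dilations of \<open>u\<close>, whose superlevel sets increase to that of \<open>u\<close>.
\<close>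

lemma radial_maximal_inequality_disc:
  assumes u: "u holomorphic_on ball 0 1" and L: "0 < L" and K: "\<And>\<rho>. 0 \<le> \<rho> \<Longrightarrow> \<rho> < 1 \<Longrightarrow> (LINT \<zeta>|circle_measure. norm (u (of_real \<rho> * \<zeta>))) \<le> K"
  shows "measure circle_measure (radially_above u L) \<le> 15 / L * K"
proof -
  define A where "A = (\<lambda>k. radially_above (\<lambda>z. u (of_real (radius_seq k) * z)) L)"
  have cont: "continuous_on (ball 0 1) u"
    using u by (rule holomorphic_on_imp_continuous_on)
  have mult_ball: "norm (of_real (radius_seq k) * z) < 1" if "norm z \<le> 1" for z :: complex and k
  proof -
    have "radius_seq k * norm z \<le> radius_seq k * 1" using that radius_seq[of k] by (intro mult_left_mono) auto
    also have "\<dots> < 1" using radius_seq[of k] by simp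
    finally show ?thesis using radius_seq[of k] by (simp add: norm_mult)
  qed
  have ck: "continuous_on (cball 0 1) (\<lambda>z. u (of_real (radius_seq k) * z))" for k
    by (rule continuous_on_compose2[OF cont]) (use mult_ball in \<open>auto intro!: continuous_intros\<close>)
  have hk: "(\<lambda>z. u (of_real (radius_seq k) * z)) holomorphic_on ball 0 1" for k
  proof -
    have "(u \<circ> (\<lambda>z. of_real (radius_seq k) * z)) holomorphic_on ball 0 1"
      by (rule holomorphic_on_compose_gen[OF _ u]) (use mult_ball in \<open>auto intro!: holomorphic_intros\<close>)
    then show ?thesis by (simp add: o_def)
  qed
  have "incseq A"
  proof (rule incseq_SucI, rule subsetI)
    fix k \<zeta> assume "\<zeta> \<in> A k"
    then obtain r where r: "norm \<zeta> = 1" "0 \<le> r" "r < 1" "L < norm (u (of_real (radius_seq k) * (of_real r * \<zeta>)))"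
      by (auto simp: A_def radially_above_def)
    define r' where "r' = r * (radius_seq k / radius_seq (Suc k))"
    have q: "0 \<le> radius_seq k / radius_seq (Suc k)" "radius_seq k / radius_seq (Suc k) \<le> 1"
      using radius_seq[of k] radius_seq[of "Suc k"] radius_seq_mono[of k "Suc k"] by auto
    have r'_le: "r' \<le> r * 1" unfolding r'_def using q r by (intro mult_left_mono) auto
    have r'_nonneg: "0 \<le> r'" unfolding r'_def by (intro mult_nonneg_nonneg q r)
    have eq: "of_real (radius_seq (Suc k)) * (of_real r' * \<zeta>) = of_real (radius_seq k) * (of_real r * \<zeta>)"
      using radius_seq[of "Suc k"] by (simp add: r'_def)
    have "L < norm (u (of_real (radius_seq (Suc k)) * (of_real r' * \<zeta>)))"
      unfolding eq by (rule r(4))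
    then show "\<zeta> \<in> A (Suc k)"
      using r r'_le r'_nonneg by (auto simp: A_def radially_above_def intro!: bexI[of _ r'])
  qed
  have un: "(\<Union>k. A k) = radially_above u L"
  proof (intro antisym subsetI)
    fix \<zeta> assume "\<zeta> \<in> (\<Union>k. A k)"
    then obtain k r where r: "norm \<zeta> = 1" "0 \<le> r" "r < 1" "L < norm (u (of_real (radius_seq k) * (of_real r * \<zeta>)))"
      by (auto simp: A_def radially_above_def)
    have "radius_seq k * r \<le> 1 * r" using r radius_seq[of k] by (intro mult_right_mono) auto
    then show "\<zeta> \<in> radially_above u L"
      using r radius_seq[of k] by (auto simp: radially_above_def mult.assoc intro!: bexI[of _ "radius_seq k * r"])
  next
    fix \<zeta> assume "\<zeta> \<in> radially_above u L"
    then obtain r where r: "norm \<zeta> = 1" "0 \<le> r" "r < 1" "L < norm (u (of_real r * \<zeta>))"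
      by (auto simp: radially_above_def)
    have "\<forall>\<^sub>F k in sequentially. r < radius_seq k"
      using radius_seq_LIMSEQ r(3) by (rule order_tendstoD)
    then obtain k where k: "r < radius_seq k"
      by (auto simp: eventually_sequentially)
    then have "r / radius_seq k < 1" "0 \<le> r / radius_seq k" using r radius_seq[of k] by auto
    moreover have "of_real (radius_seq k) * (of_real (r / radius_seq k) * \<zeta>) = of_real r * \<zeta>"
      using radius_seq[of k] by simp
    ultimately have "\<zeta> \<in> A k"
      using r by (auto simp: A_def radially_above_def intro!: bexI[of _ "r / radius_seq k"])
    then show "\<zeta> \<in> (\<Union>k. A k)" by blast
  qed
  have "range A \<subseteq> sets circle_measure"
    unfolding A_def by (auto intro!: sets_radially_above continuous_on_subset[OF ck])
  then have "(\<lambda>k. measure circle_measure (A k)) \<longlonglongrightarrow> measure circle_measure (radially_above u L)"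
    using circle.finite_Lim_measure_incseq[OF _ \<open>incseq A\<close>] un by simp
  moreover have "measure circle_measure (A k) \<le> 15 / L * K" for k
  proof -
    have "measure circle_measure (A k) \<le> 15 / L * (LINT \<zeta>|circle_measure. norm (u (of_real (radius_seq k) * \<zeta>)))"
      unfolding A_def by (rule radial_maximal_inequality[OF ck hk L])
    also have "\<dots> \<le> 15 / L * K"
      using L radius_seq[of k] by (intro mult_left_mono K) auto
    finally show ?thesis .
  qed
  ultimately show ?thesis by (blast intro: LIMSEQ_le_const2)
qed

text \<open>
The distance between \<open>h\<close> and its dilations is small in mean, hence by the maximal inequality it is
small along whole radii outside small sets. The bound on the mean square is turned into one on the mean
by \<open>x \<le> \<kappa> + x\<^sup>2 / \<kappa>\<close>.
\<close>

lemma radial_oscillation_null: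
  assumes h: "h holomorphic_on ball 0 1" and B: "\<And>z. norm z < 1 \<Longrightarrow> norm (h z) \<le> B" and L: "0 < L"
  shows "(\<Inter>j. radially_above (\<lambda>z. h z - h (of_real (radius_seq j) * z)) L) \<in> null_sets circle_measure"
proof -
  define u where "u = (\<lambda>j z. h z - h (of_real (radius_seq j) * z))"
  obtain \<delta> :: "nat \<Rightarrow> real" where \<delta>: "\<delta> \<longlonglongrightarrow> 0"
    "\<And>j \<rho>. 0 \<le> \<rho> \<Longrightarrow> \<rho> < 1 \<Longrightarrow> (LINT \<zeta>|circle_measure. (norm (u j (of_real \<rho> * \<zeta>)))\<^sup>2) \<le> \<delta> j"
    using dilation_mean_close[OF h B] unfolding u_def by metis
  have hol: "u j holomorphic_on ball 0 1" for j
  proof -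
    have "norm (of_real (radius_seq j) * z) < 1" if "norm z < 1" for z :: complex
    proof -
      have "radius_seq j * norm z \<le> 1 * norm z" using radius_seq[of j] by (intro mult_right_mono) auto
      then show ?thesis using that radius_seq[of j] by (simp add: norm_mult)
    qed
    then have "(h \<circ> (\<lambda>z. of_real (radius_seq j) * z)) holomorphic_on ball 0 1"
      by (intro holomorphic_on_compose_gen[OF _ h]) (auto intro!: holomorphic_intros)
    then show ?thesis
      unfolding u_def by (intro holomorphic_intros h) (simp add: o_def)
  qed
  have cont: "continuous_on (ball 0 1) (u j)" for j
    using hol by (rule holomorphic_on_imp_continuous_on)
  define N where "N = (\<Inter>j. radially_above (u j) L)"
  have sets: "radially_above (u j) L \<in> sets circle_measure" for j
    by (rule sets_radially_above[OF cont])
  then have N: "N \<in> sets circle_measure"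
    unfolding N_def by blast
  have le: "measure circle_measure N \<le> 15 / L * (\<kappa> + \<delta> j / \<kappa>)" if \<kappa>: "0 < \<kappa>" for \<kappa> j
  proof -
    have "measure circle_measure N \<le> measure circle_measure (radially_above (u j) L)"
      by (intro circle.finite_measure_mono sets) (auto simp: N_def)
    also have "\<dots> \<le> 15 / L * (\<kappa> + \<delta> j / \<kappa>)"
    proof (rule radial_maximal_inequality_disc[OF hol L])
      fix \<rho> :: real assume \<rho>: "0 \<le> \<rho>" "\<rho> < 1"
      have cr: "continuous_on (sphere 0 1) (\<lambda>\<zeta>. u j (of_real \<rho> * \<zeta>))"
        by (rule continuous_on_compose2[OF cont]) (use \<rho> in \<open>auto intro!: continuous_intros simp: norm_mult\<close>)
      have am: "x \<le> \<kappa> + x\<^sup>2 / \<kappa>" for x :: real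
      proof -
        have "0 \<le> (x - \<kappa>)\<^sup>2 + \<kappa> * x \<or> x \<le> 0" using \<kappa> by (cases "x \<le> 0") auto
        then show ?thesis
        proof
          assume "x \<le> 0"
          moreover have "0 \<le> x\<^sup>2 / \<kappa>" using \<kappa> by simp
          ultimately show ?thesis using \<kappa> by linarith
        next
          assume "0 \<le> (x - \<kappa>)\<^sup>2 + \<kappa> * x"
          then have "x * \<kappa> \<le> \<kappa> * \<kappa> + x\<^sup>2" by (simp add: power2_eq_square algebra_simps)
          then show ?thesis using \<kappa> by (simp add: field_simps)
        qed
      qed
      have "(LINT \<zeta>|circle_measure. norm (u j (of_real \<rho> * \<zeta>))) \<le> (LINT \<zeta>|circle_measure. \<kappa> + (norm (u j (of_real \<rho> * \<zeta>)))\<^sup>2 / \<kappa>)"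
        by (intro integral_mono integrable_circle continuous_intros cr am) (use \<kappa> in auto)
      also have "\<dots> = (LINT \<zeta>|circle_measure. \<kappa>) + (LINT \<zeta>|circle_measure. (norm (u j (of_real \<rho> * \<zeta>)))\<^sup>2 / \<kappa>)"
        by (intro Bochner_Integration.integral_add integrable_circle continuous_intros cr) (use \<kappa> in auto)
      also have "\<dots> = \<kappa> + (LINT \<zeta>|circle_measure. (norm (u j (of_real \<rho> * \<zeta>)))\<^sup>2) / \<kappa>"
        by (simp add: measure_def space_circle_measure emeasure_circle_measure)
      also have "\<dots> \<le> \<kappa> + \<delta> j / \<kappa>"
        using \<delta>(2)[OF \<rho>] \<kappa> by (simp add: divide_right_mono)
      finally show "(LINT \<zeta>|circle_measure. norm (u j (of_real \<rho> * \<zeta>))) \<le> \<kappa> + \<delta> j / \<kappa>" .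
    qed
    finally show ?thesis .
  qed
  have "measure circle_measure N \<le> 15 / L * (\<kappa> + 0 / \<kappa>)" if \<kappa>: "0 < \<kappa>" for \<kappa>
  proof (rule LIMSEQ_le_const)
    show "(\<lambda>j. 15 / L * (\<kappa> + \<delta> j / \<kappa>)) \<longlonglongrightarrow> 15 / L * (\<kappa> + 0 / \<kappa>)"
      using \<kappa> by (intro tendsto_intros \<delta>) auto
  qed (use le[OF \<kappa>] in auto)
  then have "measure circle_measure N \<le> 15 / L * \<kappa>" if "0 < \<kappa>" for \<kappa>
    using that by simp
  from this[of "L / 15 * _"] have "measure circle_measure N \<le> e" if "0 < e" for e
    using that L by (simp add: field_simps)
  then have "measure circle_measure N \<le> 0"
    by (rule field_le_epsilon[of _ 0, simplified])
  then have "measure circle_measure N = 0"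
    using measure_nonneg[of circle_measure N] by linarith
  then have "N \<in> null_sets circle_measure"
    using N by (simp add: null_sets_def circle.emeasure_eq_measure)
  then show ?thesis by (simp add: N_def u_def)
qed

text \<open>
On a radius outside the exceptional null sets \<open>h\<close> is uniformly close to some dilation of itself,
which converges because it is continuous up to the circle. Hence \<open>h\<close> is Cauchy along that radius.
\<close>

theorem Fatou_radial_limits:
  assumes h: "h holomorphic_on ball 0 1" and B: "\<And>z. norm z < 1 \<Longrightarrow> norm (h z) \<le> B"
  shows "AE \<zeta> in circle_measure. ((\<lambda>r. h (of_real r * \<zeta>)) \<longlongrightarrow> boundary_value h \<zeta>) (at_left 1)"
proof -
  define N where "N = (\<lambda>k::nat. \<Inter>j. radially_above (\<lambda>z. h z - h (of_real (radius_seq j) * z)) (inverse (real (Suc k))))"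
  have "AE \<zeta> in circle_measure. \<forall>k. \<zeta> \<notin> N k"
    unfolding AE_all_countable N_def
    by (intro allI AE_not_in radial_oscillation_null[OF h B]) auto
  then show ?thesis
  proof (rule AE_mp, intro AE_I2 impI)
    fix \<zeta> assume \<zeta>: "\<zeta> \<in> space circle_measure" and notN: "\<forall>k. \<zeta> \<notin> N k"
    define g where "g = (\<lambda>r::real. h (of_real r * \<zeta>))"
    have n\<zeta>: "norm \<zeta> = 1" using \<zeta> by (simp add: space_circle_measure)
    have near: "\<exists>w. \<forall>\<^sub>F r in at_left 1. dist (g r) w < e" if e: "0 < e" for e
    proof -
      obtain k where k: "inverse (real (Suc k)) < e / 2"
        using reals_Archimedean[of "e / 2"] e by auto
      obtain j where j: "\<And>r. 0 \<le> r \<Longrightarrow> r < 1 \<Longrightarrow> norm (g r - h (of_real (radius_seq j) * (of_real r * \<zeta>))) \<le> inverse (real (Suc k))"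
        using notN n\<zeta> unfolding N_def radially_above_def g_def by (force simp: not_less)
      define w where "w = h (of_real (radius_seq j) * \<zeta>)"
      have "isCont h (of_real (radius_seq j) * \<zeta>)"
        using holomorphic_on_imp_continuous_on[OF h] radius_seq[of j] n\<zeta>
        by (simp add: continuous_on_eq_continuous_at norm_mult)
      then have "((\<lambda>r. h (of_real (radius_seq j) * (of_real r * \<zeta>))) \<longlongrightarrow> w) (at_left 1)"
        unfolding w_def by (rule isCont_tendsto_compose) (auto intro!: tendsto_eq_intros)
      then have "\<forall>\<^sub>F r in at_left 1. dist (h (of_real (radius_seq j) * (of_real r * \<zeta>))) w < e / 2"
        using e by (intro tendstoD) auto
      moreover have "\<forall>\<^sub>F r in at_left (1::real). r \<in> {0<..<1}"
        by (rule eventually_at_left_real) simp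
      ultimately have "\<forall>\<^sub>F r in at_left 1. dist (g r) w < e"
      proof eventually_elim
        case (elim r)
        have "dist (g r) w \<le> dist (g r) (h (of_real (radius_seq j) * (of_real r * \<zeta>))) + dist (h (of_real (radius_seq j) * (of_real r * \<zeta>))) w"
          by (rule dist_triangle)
        moreover have "dist (g r) (h (of_real (radius_seq j) * (of_real r * \<zeta>))) < e / 2"
          using j[of r] elim k by (simp add: dist_norm)
        ultimately show ?case using elim by linarith
      qed
      then show ?thesis by blast
    qed
    have "cauchy_filter (filtermap g (at_left 1))"
      unfolding cauchy_filter_metric_filtermap
    proof (intro allI impI)
      fix e :: real assume "0 < e"
      then obtain w where "\<forall>\<^sub>F r in at_left 1. dist (g r) w < e / 2"
        using near[of "e / 2"] by auto
      moreover have "dist x y < e" if "dist x w < e / 2" "dist y w < e / 2" for x y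
        using that by (rule dist_triangle_half_l[unfolded dist_commute[of w]]) 
      ultimately show "\<exists>P. eventually P (at_left 1) \<and> (\<forall>x y. P x \<and> P y \<longrightarrow> dist (g x) (g y) < e)"
        by (intro exI[of _ "\<lambda>r. dist (g r) w < e / 2"]) blast
    qed
    moreover have "filtermap g (at_left 1) \<noteq> bot"
      by (simp add: filtermap_bot_iff)
    moreover have "complete (UNIV :: complex set)" by (rule complete_UNIV)
    ultimately obtain l where "filtermap g (at_left 1) \<le> nhds l"
      unfolding complete_uniform by auto
    then have l: "(g \<longlongrightarrow> l) (at_left 1)"
      by (simp add: filterlim_def)
    then have "boundary_value h \<zeta> = l"
      unfolding boundary_value_def g_def[symmetric] by (intro tendsto_Lim) auto
    with l show "((\<lambda>r. h (of_real r * \<zeta>)) \<longlongrightarrow> boundary_value h \<zeta>) (at_left 1)"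
      by (simp add: g_def)
  qed
qed


section \<open>The norm of the Toeplitz operator\<close>

text \<open>
Transfer of the smooth case by dominated convergence along the dilations. If the integrand of
the Toeplitz operator is not integrable, its integral is \<open>0\<close> by convention and the bound is trivial, so
measurability of \<^const>\<open>boundary_value\<close> never has to be discussed.
\<close>

lemma toeplitz_bound:
  assumes f: "f holomorphic_on ball 0 1" and fM: "\<And>w. norm w < 1 \<Longrightarrow> norm (f w) \<le> M"
    and h: "h holomorphic_on ball 0 1" and h1: "\<And>w. norm w < 1 \<Longrightarrow> norm (h w) \<le> 1"
    and K: "\<And>r. 0 \<le> r \<Longrightarrow> r < 1 \<Longrightarrow> (LINT \<zeta>|circle_measure. norm (deriv f (of_real r * \<zeta>))) \<le> K"
    and z: "norm z < 1"
  shows "norm (toeplitz f h z) \<le> M + pi * K"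
proof -
  define I where "I = (\<lambda>\<zeta>. cnj (boundary_value f \<zeta>) * boundary_value h \<zeta> / (1 - cnj \<zeta> * z))"
  define F where "F = (\<lambda>n \<zeta>. cnj (f (of_real (radius_seq n) * \<zeta>)) * h (of_real (radius_seq n) * \<zeta>) / (1 - cnj \<zeta> * z))"
  have M0: "0 \<le> M" using fM[of 0] by (auto intro: order_trans[OF norm_ge_zero])
  have K0: "0 \<le> K" using K[of 0] by (auto intro: order_trans[rotated])
  have cf: "continuous_on (ball 0 1) f" and ch: "continuous_on (ball 0 1) h"
    using f h by (auto intro: holomorphic_on_imp_continuous_on)
  have cfr: "continuous_on (sphere 0 1) (\<lambda>\<zeta>. f (of_real (radius_seq n) * \<zeta>))"
    and chr: "continuous_on (sphere 0 1) (\<lambda>\<zeta>. h (of_real (radius_seq n) * \<zeta>))" for n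
    using radius_seq[of n]
    by (auto intro!: continuous_on_compose2[OF cf] continuous_on_compose2[OF ch] continuous_intros simp: norm_mult)
  have cF: "continuous_on (sphere 0 1) (F n)" for n
    unfolding F_def
    by (intro continuous_intros cfr chr) (use one_minus_cnj_mult_neq_0[OF z] in auto)
  have bound: "norm (LINT \<zeta>|circle_measure. F n \<zeta>) \<le> M + pi * K" for n
  proof -
    define r where "r = radius_seq n"
    have r: "0 < r" "r < 1" using radius_seq by (auto simp: r_def)
    define R where "R = 1 / r"
    have R: "1 < R" using r by (simp add: R_def)
    have ballR: "of_real r * w \<in> ball 0 1" if "w \<in> ball 0 R" for w :: complex
      using that r by (simp add: R_def norm_mult field_simps)
    have ball1: "norm (of_real r * w) < 1" if "norm w \<le> 1" for w :: complex
      using ballR[of w] that R by auto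
    have fr: "(\<lambda>w. f (of_real r * w)) holomorphic_on ball 0 R" and hr: "(\<lambda>w. h (of_real r * w)) holomorphic_on ball 0 R"
    proof -
      have "(f \<circ> (\<lambda>w. of_real r * w)) holomorphic_on ball 0 R" "(h \<circ> (\<lambda>w. of_real r * w)) holomorphic_on ball 0 R"
        by (rule holomorphic_on_compose_gen[OF _ f] holomorphic_on_compose_gen[OF _ h];
            use ballR in \<open>auto intro!: holomorphic_intros\<close>)+
      then show "(\<lambda>w. f (of_real r * w)) holomorphic_on ball 0 R" "(\<lambda>w. h (of_real r * w)) holomorphic_on ball 0 R"
        by (simp_all add: o_def)
    qed
    have dr: "deriv (\<lambda>w. f (of_real r * w)) \<zeta> = of_real r * deriv f (of_real r * \<zeta>)" if "norm \<zeta> = 1" for \<zeta>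
    proof (rule DERIV_imp_deriv)
      have "(f has_field_derivative deriv f (of_real r * \<zeta>)) (at (of_real r * \<zeta>))"
        using ball1[of \<zeta>] that by (intro holomorphic_derivI[OF f]) auto
      then have "((\<lambda>w. f (of_real r * w)) has_field_derivative deriv f (of_real r * \<zeta>) * of_real r) (at \<zeta>)"
        by (rule DERIV_chain2) (auto intro!: derivative_eq_intros)
      then show "((\<lambda>w. f (of_real r * w)) has_field_derivative of_real r * deriv f (of_real r * \<zeta>)) (at \<zeta>)"
        by (simp add: mult.commute)
    qed
    have "norm (LINT \<zeta>|circle_measure. F n \<zeta>) \<le> M + pi * (LINT \<zeta>|circle_measure. norm (deriv (\<lambda>w. f (of_real r * w)) \<zeta>))"
      unfolding F_def r_def[symmetric]
      by (rule toeplitz_bound_smooth[OF R fr hr]) (use fM h1 ball1 z in auto)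
    also have "(LINT \<zeta>|circle_measure. norm (deriv (\<lambda>w. f (of_real r * w)) \<zeta>)) =
        (LINT \<zeta>|circle_measure. r * norm (deriv f (of_real r * \<zeta>)))"
      by (intro Bochner_Integration.integral_cong) (use r in \<open>auto simp: space_circle_measure dr norm_mult\<close>)
    also have "\<dots> = r * (LINT \<zeta>|circle_measure. norm (deriv f (of_real r * \<zeta>)))"
      by simp
    also have "\<dots> \<le> 1 * K"
      using r by (intro mult_mono K) auto
    finally show ?thesis by simp
  qed
  show ?thesis
  proof (cases "integrable circle_measure I")
    case False
    then have "toeplitz f h z = 0"
      unfolding toeplitz_def I_def by (rule not_integrable_integral_eq)
    then show ?thesis using M0 K0 by simp
  next
    case True
    have "(\<lambda>n. LINT \<zeta>|circle_measure. F n \<zeta>) \<longlonglongrightarrow> (LINT \<zeta>|circle_measure. I \<zeta>)"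
    proof (rule integral_dominated_convergence)
      have rl: "AE \<zeta> in circle_measure. ((\<lambda>r. f (of_real r * \<zeta>)) \<longlongrightarrow> boundary_value f \<zeta>) (at_left 1)"
          "AE \<zeta> in circle_measure. ((\<lambda>r. h (of_real r * \<zeta>)) \<longlongrightarrow> boundary_value h \<zeta>) (at_left 1)"
        by (rule Fatou_radial_limits[OF f], rule fM, assumption)
           (rule Fatou_radial_limits[OF h], rule h1, assumption)
      show "I \<in> borel_measurable circle_measure" using True by auto
      show "F n \<in> borel_measurable circle_measure" for n
        by (rule borel_measurable_circle[OF cF])
      show "integrable circle_measure (\<lambda>_. M / (1 - norm z))" by simp
      show "AE \<zeta> in circle_measure. (\<lambda>n. F n \<zeta>) \<longlonglongrightarrow> I \<zeta>"
        using rl AE_space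
      proof eventually_elim
        case (elim \<zeta>)
        note fl = filterlim_compose[OF elim(1) filterlim_radius_seq]
        note hl = filterlim_compose[OF elim(2) filterlim_radius_seq]
        show ?case
          unfolding F_def I_def
          by (intro tendsto_intros fl hl) (use one_minus_cnj_mult_neq_0[OF z] elim(3) in \<open>auto simp: space_circle_measure\<close>)
      qed
      show "AE \<zeta> in circle_measure. norm (F n \<zeta>) \<le> M / (1 - norm z)" for n
      proof (rule AE_I2)
        fix \<zeta> assume "\<zeta> \<in> space circle_measure"
        then have n\<zeta>: "norm \<zeta> = 1" by (simp add: space_circle_measure)
        have "1 - norm z \<le> norm (1 - cnj \<zeta> * z)"
          using norm_triangle_ineq2[of 1 "cnj \<zeta> * z"] n\<zeta> by (simp add: norm_mult)
        moreover have "norm (f (of_real (radius_seq n) * \<zeta>)) * norm (h (of_real (radius_seq n) * \<zeta>)) \<le> M * 1"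
          using radius_seq[of n] n\<zeta> by (intro mult_mono fM h1 M0) (auto simp: norm_mult)
        ultimately show "norm (F n \<zeta>) \<le> M / (1 - norm z)"
          unfolding F_def norm_divide norm_mult complex_mod_cnj using z M0 by (intro frac_le) auto
      qed
    qed
    then have "(\<lambda>n. norm (LINT \<zeta>|circle_measure. F n \<zeta>)) \<longlonglongrightarrow> norm (LINT \<zeta>|circle_measure. I \<zeta>)"
      by (rule tendsto_norm)
    then have "norm (LINT \<zeta>|circle_measure. I \<zeta>) \<le> M + pi * K"
      using bound by (blast intro: LIMSEQ_le_const2)
    then show ?thesis by (simp add: toeplitz_def I_def)
  qed
qed

lemma hardy_norm_1:
  "hardy_norm 1 g = (SUP r\<in>{0..<1}. ereal (LINT \<zeta>|circle_measure. norm (g (of_real r * \<zeta>))))"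
  unfolding hardy_norm_def
  by (intro SUP_cong refl) (simp add: integral_nonneg_AE)

text \<open>
If \<open>f\<close> is unbounded, the right-hand side is infinite; otherwise \<open>f\<close> has radial limits almost
everywhere by Fatou's theorem and the bound applies.
\<close>

theorem theorem2:
  fixes f :: "complex \<Rightarrow> complex"
  assumes "f holomorphic_on ball 0 1"
    and "deriv f \<in> hardy 1"
  shows "hardy_inf_opnorm (toeplitz f) \<le> hardy_inf_norm f + ereal pi * hardy_norm 1 (deriv f)"
proof -
  have inf_norm_ge: "ereal (norm (g w)) \<le> hardy_inf_norm g" if "norm w < 1" for g w
    unfolding hardy_inf_norm_def by (rule SUP_upper) (use that in auto)
  have mean_le: "ereal (LINT \<zeta>|circle_measure. norm (deriv f (of_real r * \<zeta>))) \<le> hardy_norm 1 (deriv f)"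
    if "0 \<le> r" "r < 1" for r
    unfolding hardy_norm_1 by (rule SUP_upper) (use that in auto)
  have fin: "hardy_norm 1 (deriv f) < \<infinity>"
    using assms(2) by (simp add: hardy_def)
  moreover have "0 \<le> hardy_norm 1 (deriv f)"
    using mean_le[of 0] by (rule order_trans[rotated]) (auto intro!: integral_nonneg_AE)
  ultimately obtain K where K: "hardy_norm 1 (deriv f) = ereal K"
    by (cases "hardy_norm 1 (deriv f)") auto
  have "0 \<le> hardy_inf_norm f"
    using inf_norm_ge[of 0 f] by (rule order_trans[rotated]) auto
  then consider "hardy_inf_norm f = \<infinity>" | M where "hardy_inf_norm f = ereal M"
    by (cases "hardy_inf_norm f") auto
  then show ?thesis
  proof cases
    case 1
    then show ?thesis by (simp add: K)
  next
    case (2 M)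
    show ?thesis
      unfolding hardy_inf_opnorm_def
    proof (rule SUP_least)
      fix h assume "h \<in> {h \<in> hardy_inf. hardy_inf_norm h \<le> 1}"
      then have h: "h holomorphic_on ball 0 1" "hardy_inf_norm h \<le> 1"
        by (auto simp: hardy_inf_def)
      show "hardy_inf_norm (toeplitz f h) \<le> hardy_inf_norm f + ereal pi * hardy_norm 1 (deriv f)"
        unfolding hardy_inf_norm_def[of "toeplitz f h"]
      proof (rule SUP_least)
        fix z :: complex assume "z \<in> ball 0 1"
        have "norm (toeplitz f h z) \<le> M + pi * K"
        proof (rule toeplitz_bound[OF assms(1) _ h(1)])
          show "norm (f w) \<le> M" if "norm w < 1" for w
            using inf_norm_ge[OF that, of f] 2 by simp
          show "norm (h w) \<le> 1" if "norm w < 1" for w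
            using order_trans[OF inf_norm_ge[OF that, of h] h(2)] by simp
          show "(LINT \<zeta>|circle_measure. norm (deriv f (of_real r * \<zeta>))) \<le> K" if "0 \<le> r" "r < 1" for r
            using mean_le[OF that] K by simp
        qed (use \<open>z \<in> ball 0 1\<close> in auto)
        then show "ereal (norm (toeplitz f h z)) \<le> hardy_inf_norm f + ereal pi * hardy_norm 1 (deriv f)"
          by (simp add: 2 K)
      qed
    qed
  qed
qed

end
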